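(* Let $\tau$ be an arbitrary $\mathcal G$-stopping rule. Consider $\mu\in\mathbb{R}^D$ and $i_0\in\{1,\ldots,D-1\}$ such that $V_{i_0+1}\ge 200\,\mathcal R(\mu,\tau)^2$. Then $$\mathcal R(\bar\mu,\tau)^2\ge 0.05\,B_{i_0}^2(\bar\mu)$$ holds for any $\bar\mu\in\mathbb{R}^D$ that satisfies (a) $\mu_i=\bar\mu_i$ for all $i\le i_0$, (b) the weak bias bound $|B_{i_0,\lambda}^2(\bar\mu)-B_{i_0,\lambda}^2(\mu)|\le 0.05\,\frac{\sqrt{D-i_0}}{2}\,\delta^2$, and (c) $B_{i_0,\lambda}(\mu)+B_{i_0,\lambda}(\bar\mu)\ge 5.25\,\delta$. Moreover, if $\mathcal R(\mu,\tau)^2\le C_\mu\mathcal R(\mu,m_{\mathfrak s})^2$ holds with some $C_\mu\ge 1$, where $m_{\mathfrak s}=m_{\mathfrak s}(\mu)$, then any $i_0\in\{1,\ldots,D-1\}$ with $i_0\ge 400\,C_\mu m_{\mathfrak s}$ satisfies the requirement $V_{i_0+1}\ge 200\,\mathcal R(\mu,\tau)^2$.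
   Context: Model: $D\ge 1$ is an integer, $\delta>0$, $\lambda_1\ge\cdots\ge\lambda_D>0$ are known, and for a signal $\mu\in\mathbb{R}^D$ one observes $Y_i=\lambda_i\mu_i+\delta\varepsilon_i$, $i=1,\ldots,D$, with $\varepsilon_i$ independent $N(0,1)$; $\mathbb{E}_\mu$ is expectation under signal $\mu$. Truncated SVD estimators: $\widehat\mu^{(m)}_i=\mathbf 1(i\le m)\lambda_i^{-1}Y_i$, $0\le m\le D$. $\|\cdot\|$ is the Euclidean norm. Squared strong bias $B_m^2(\mu)=\sum_{i=m+1}^D\mu_i^2$; squared weak bias $B_{m,\lambda}^2(\mu)=\sum_{i=m+1}^D\lambda_i^2\mu_i^2$ (with $B_{m,\lambda}(\mu)\ge 0$ its square root); strong variance $V_m=\delta^2\sum_{i=1}^m\lambda_i^{-2}$. Strongly balanced oracle: $m_{\mathfrak s}(\mu)=\min\{m\in\{0,\ldots,D\}:V_m\ge B_m^2(\mu)\}$. Residual filtration: $\mathcal G_m=\sigma(Y_1,\ldots,Y_m)\vee\sigma(\|Y\|^2)$, $0\le m\le D$, where $\|Y\|^2=\sum_{i=1}^DY_i^2$. A $\mathcal G$-stopping rule is a stopping time $\tau$ with respect to $(\mathcal G_m)_{0\le m\le D}$ with values in $\{0,\ldots,D\}$ (a fixed function of the data, the same for all signals). For a (possibly random) index $\tau$, $\mathcal R(\mu,\tau)^2=\mathbb{E}_\mu[\|\widehat\mu^{(\tau)}-\mu\|^2]$. *)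

theory Defs
  imports "HOL-Probability.Probability"
begin

text \<open>
  Vectors of \<open>\<real>\<^sup>D\<close> are functions \<^typ>\<open>nat \<Rightarrow> real\<close> of which only the
  coordinates in \<open>{1..D}\<close> are used. The noise \<open>\<epsilon>\<close> lives on a probability space \<open>M\<close> that does not
  depend on the signal \<open>\<mu>\<close>, so that \<open>\<bbbE>\<^sub>\<mu>\<close> of a function of the data is the integral over \<open>M\<close> of that
  function composed with \<open>observation \<dots> \<mu>\<close>.
\<close>

definition gaussian_sequence_model ::
    "'a measure \<Rightarrow> nat \<Rightarrow> real \<Rightarrow> (nat \<Rightarrow> real) \<Rightarrow> (nat \<Rightarrow> 'a \<Rightarrow> real) \<Rightarrow> bool" where
  "gaussian_sequence_model M D \<delta> lam \<epsilon> \<longleftrightarrow>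
     prob_space M \<and> 1 \<le> D \<and> 0 < \<delta> \<and>
     antimono_on {1..D} lam \<and> 0 < lam D \<and>
     prob_space.indep_vars M (\<lambda>_. borel) \<epsilon> {1..D} \<and>
     (\<forall>i\<in>{1..D}. distributed M lborel (\<epsilon> i) std_normal_density)"

definition observation ::
    "nat \<Rightarrow> real \<Rightarrow> (nat \<Rightarrow> real) \<Rightarrow> (nat \<Rightarrow> 'a \<Rightarrow> real) \<Rightarrow> (nat \<Rightarrow> real) \<Rightarrow> 'a \<Rightarrow> (nat \<Rightarrow> real)" where
  "observation D \<delta> lam \<epsilon> \<mu> \<omega> = (\<lambda>i\<in>{1..D}. lam i * \<mu> i + \<delta> * \<epsilon> i \<omega>)"

definition tsvd :: "(nat \<Rightarrow> real) \<Rightarrow> nat \<Rightarrow> (nat \<Rightarrow> real) \<Rightarrow> nat \<Rightarrow> real" where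
  "tsvd lam m y i = (if i \<le> m then inverse (lam i) * y i else 0)"

definition strong_bias_sq :: "nat \<Rightarrow> nat \<Rightarrow> (nat \<Rightarrow> real) \<Rightarrow> real" where
  "strong_bias_sq D m \<mu> = (\<Sum>i=m+1..D. (\<mu> i)\<^sup>2)"

definition weak_bias_sq :: "nat \<Rightarrow> (nat \<Rightarrow> real) \<Rightarrow> nat \<Rightarrow> (nat \<Rightarrow> real) \<Rightarrow> real" where
  "weak_bias_sq D lam m \<mu> = (\<Sum>i=m+1..D. (lam i)\<^sup>2 * (\<mu> i)\<^sup>2)"

definition weak_bias :: "nat \<Rightarrow> (nat \<Rightarrow> real) \<Rightarrow> nat \<Rightarrow> (nat \<Rightarrow> real) \<Rightarrow> real" where
  "weak_bias D lam m \<mu> = sqrt (weak_bias_sq D lam m \<mu>)"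

definition strong_variance :: "real \<Rightarrow> (nat \<Rightarrow> real) \<Rightarrow> nat \<Rightarrow> real" where
  "strong_variance \<delta> lam m = \<delta>\<^sup>2 * (\<Sum>i=1..m. inverse ((lam i)\<^sup>2))"

definition strong_oracle :: "nat \<Rightarrow> real \<Rightarrow> (nat \<Rightarrow> real) \<Rightarrow> (nat \<Rightarrow> real) \<Rightarrow> nat" where
  "strong_oracle D \<delta> lam \<mu> =
     Min {m \<in> {0..D}. strong_bias_sq D m \<mu> \<le> strong_variance \<delta> lam m}"

definition data_space :: "nat \<Rightarrow> (nat \<Rightarrow> real) set" where
  "data_space D = {1..D} \<rightarrow>\<^sub>E UNIV"

text \<open>
  The residual filtration on the space of data vectors, where the coordinate maps play the role of
  the observations. It is made constant for \<open>m \<ge> D\<close>, since the library's notion of stopping time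
  uses the whole index type.
\<close>

definition residual_filtration :: "nat \<Rightarrow> nat \<Rightarrow> (nat \<Rightarrow> real) measure" where
  "residual_filtration D m = sigma (data_space D)
     ({(\<lambda>y. y i) -` A \<inter> data_space D | i A. i \<in> {1..min m D} \<and> A \<in> sets borel} \<union>
      {(\<lambda>y. (L2_set y {1..D})\<^sup>2) -` A \<inter> data_space D | A. A \<in> sets borel})"

lemma filtration_residual_filtration: "filtration (data_space D) (residual_filtration D)"
proof
  fix m n :: nat
  assume "m \<le> n"
  then have *: "min m D \<le> min n D" by simp
  show "sets (residual_filtration D m) \<subseteq> sets (residual_filtration D n)"
    unfolding residual_filtration_def
    by (subst (1 2) sets_measure_of, blast, blast, intro sigma_sets_mono')
       (use * in \<open>fastforce dest: order_trans\<close>)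
qed (simp add: residual_filtration_def space_measure_of_conv)

definition stopping_rule :: "nat \<Rightarrow> ((nat \<Rightarrow> real) \<Rightarrow> nat) \<Rightarrow> bool" where
  "stopping_rule D \<tau> \<longleftrightarrow>
     stopping_time (residual_filtration D) \<tau> \<and> (\<forall>y\<in>data_space D. \<tau> y \<in> {0..D})"

definition sq_risk ::
    "'a measure \<Rightarrow> nat \<Rightarrow> real \<Rightarrow> (nat \<Rightarrow> real) \<Rightarrow> (nat \<Rightarrow> 'a \<Rightarrow> real) \<Rightarrow>
     (nat \<Rightarrow> real) \<Rightarrow> ((nat \<Rightarrow> real) \<Rightarrow> nat) \<Rightarrow> real" where
  "sq_risk M D \<delta> lam \<epsilon> \<mu> \<tau> =
     (LINT \<omega>|M. (let y = observation D \<delta> lam \<epsilon> \<mu> \<omega>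
                 in (L2_set (\<lambda>i. tsvd lam (\<tau> y) y i - \<mu> i) {1..D})\<^sup>2))"

end

theory Submission
  imports Defs
begin

text \<open>
  The rule may look at the first coordinates one after the other and, from the start, at
  \<open>\<parallel>Y\<parallel>\<^sup>2\<close>. Up to the index \<open>i\<^sub>0\<close> it therefore knows nothing of the coordinates beyond \<open>i\<^sub>0\<close>
  except the sum of their squares, and the squared norm of a Gaussian vector with a shifted mean
  reacts very weakly to the mean: its law depends on the squared length of the mean alone, and it
  hardly changes if that squared length moves by a small multiple of the square root of the
  dimension. So a rule that stops at or before \<open>i\<^sub>0\<close> under \<open>\<mu>\<close> also does so, with a probability
  bounded away from \<open>0\<close>, under every \<open>\<mu>'\<close> with the same leading coordinates and about the same weak
  bias, and then it pays the whole strong bias of \<open>\<mu>'\<close>.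

  The quantitative form of this is \<open>sq_norm_law_close\<close>: two noncentral chi-square laws with \<open>k\<close>
  degrees of freedom, whose noncentralities differ by at most \<open>\<surd>k / 5\<close>, differ by at most
  \<open>1/2\<close> on every event. For \<open>k \<ge> 2\<close>, rotation invariance (\<open>sq_norm_law_cong\<close>) puts the smaller mean
  into one coordinate, as \<open>(a, 0, \<dots>, 0)\<close>, and replaces the larger one by \<open>(a, r, \<dots>, r)\<close> with
  \<open>(k - 1) r\<^sup>2\<close> equal to the difference \<open>\<Delta>\<close> of the squared lengths. The square \<open>(r + Z)\<^sup>2\<close> of a shifted
  normal variable does not see the sign of \<open>r\<close>, so it is also the square of the equal mixture of
  \<open>r + Z\<close> and \<open>- r + Z\<close>, which has density \<open>exp (- r\<^sup>2 / 2) cosh (r x)\<close> with respect to the normal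
  law. The second moment of that density is \<open>cosh (r\<^sup>2)\<close>, which is only \<open>1 + O(r\<^sup>4)\<close>, and so the
  chi-square divergence of the product over \<open>k - 1\<close> coordinates is at most \<open>exp (\<Delta>\<^sup>2 / (k - 1)) - 1\<close>;
  the Cauchy-Schwarz inequality turns this into the bound on the probabilities. For \<open>k = 1\<close> a plain
  shift of the normal law suffices.

  It remains to see that the rule stops at or before \<open>i\<^sub>0\<close> under \<open>\<mu>\<close> often enough. On
  \<open>{\<tau> > i\<^sub>0}\<close> the loss contains the stochastic error of the first \<open>i\<^sub>0 + 1\<close> coordinates, and the second
  moment of a normal variable on an event \<open>A\<close> is at least \<open>q\<^sup>2 (P(A) - q)\<close> for every \<open>q \<ge> 0\<close>,
  since the variable lies in \<open>[-q, q]\<close> with probability at most \<open>q\<close>. Hence the risk is at least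
  \<open>V\<^bsub>i\<^sub>0+1\<^esub> q\<^sup>2 (P(\<tau> > i\<^sub>0) - q)\<close>. With \<open>q = 1/5\<close> and a risk of at most \<open>V\<^bsub>i\<^sub>0+1\<^esub> / 200\<close> this gives
  \<open>P(\<tau> > i\<^sub>0) \<le> 0.325\<close> under \<open>\<mu>\<close>, hence \<open>P(\<tau> \<le> i\<^sub>0) \<ge> 0.675 - 0.5 = 0.175\<close> under \<open>\<mu>'\<close>.

  The last claim of the theorem is a comparison of averages. At the strongly balanced index \<open>m\<close> the risk is at most
  \<open>2 V\<^sub>m\<close>, and \<open>V\<^sub>n / n\<close> grows with \<open>n\<close> because the singular values decrease.
\<close>

section \<open>Shifts of the standard normal law\<close>

abbreviation std_gauss :: "real measure" where
  "std_gauss \<equiv> density lborel (\<lambda>x. ennreal (std_normal_density x))"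

abbreviation std_gauss_PiM :: "'i set \<Rightarrow> ('i \<Rightarrow> real) measure" where
  "std_gauss_PiM J \<equiv> PiM J (\<lambda>_. std_gauss)"

lemma prob_space_std_gauss: "prob_space std_gauss"
  by (rule prob_space_normal_density) simp

interpretation gauss: prob_space std_gauss
  by (rule prob_space_std_gauss)

interpretation gauss_prod: product_sigma_finite "\<lambda>_::'i. std_gauss"
  by standard

lemma nn_integral_std_gauss:
  assumes [measurable]: "f \<in> borel_measurable borel"
  shows "(\<integral>\<^sup>+x. f x \<partial>std_gauss) = (\<integral>\<^sup>+x. ennreal (std_normal_density x) * f x \<partial>lborel)"
  by (subst nn_integral_density) auto

text \<open>
  The density of the normal law shifted by \<open>t\<close> with respect to the standard normal law.
\<close>

definition tilt :: "real \<Rightarrow> real \<Rightarrow> real" where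
  "tilt t x = exp (t * x - t\<^sup>2 / 2)"

lemma tilt_measurable [measurable]: "tilt t \<in> borel_measurable borel"
  unfolding tilt_def by measurable

lemma tilt_nonneg [simp]: "0 \<le> tilt t x"
  by (simp add: tilt_def)

lemma std_gauss_shift:
  assumes [measurable]: "k \<in> borel_measurable borel"
  shows "(\<integral>\<^sup>+x. k (t + x) \<partial>std_gauss) = (\<integral>\<^sup>+x. k x * ennreal (tilt t x) \<partial>std_gauss)"
proof -
  have eq: "std_normal_density (t + x) * tilt t (t + x) = std_normal_density x" for x
    unfolding std_normal_density_def tilt_def
    by (simp add: exp_add[symmetric]) (simp add: power2_eq_square field_simps)
  have "(\<integral>\<^sup>+x. k x * ennreal (tilt t x) \<partial>std_gauss)
      = (\<integral>\<^sup>+x. ennreal (std_normal_density x) * (k x * ennreal (tilt t x)) \<partial>lborel)"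
    by (subst nn_integral_std_gauss) auto
  also have "\<dots> = (\<integral>\<^sup>+x. ennreal (std_normal_density (t + x)) * (k (t + x) * ennreal (tilt t (t + x))) \<partial>lborel)"
    by (subst nn_integral_real_affine[where c = 1 and t = t]) auto
  also have "\<dots> = (\<integral>\<^sup>+x. ennreal (std_normal_density x) * k (t + x) \<partial>lborel)"
  proof (intro nn_integral_cong)
    fix x
    have "ennreal (std_normal_density (t + x)) * (k (t + x) * ennreal (tilt t (t + x)))
        = ennreal (std_normal_density (t + x) * tilt t (t + x)) * k (t + x)"
      by (simp add: ennreal_mult mult_ac)
    then show "ennreal (std_normal_density (t + x)) * (k (t + x) * ennreal (tilt t (t + x)))
        = ennreal (std_normal_density x) * k (t + x)"
      by (simp only: eq)
  qed
  also have "\<dots> = (\<integral>\<^sup>+x. k (t + x) \<partial>std_gauss)"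
    by (subst nn_integral_std_gauss) auto
  finally show ?thesis ..
qed

lemma std_gauss_reflect:
  assumes [measurable]: "k \<in> borel_measurable borel"
  shows "(\<integral>\<^sup>+x. k (- x) \<partial>std_gauss) = (\<integral>\<^sup>+x. k x \<partial>std_gauss)"
proof -
  have "(\<integral>\<^sup>+x. k x \<partial>std_gauss) = (\<integral>\<^sup>+x. ennreal (std_normal_density x) * k x \<partial>lborel)"
    by (subst nn_integral_std_gauss) auto
  also have "\<dots> = (\<integral>\<^sup>+x. ennreal (std_normal_density (- x)) * k (- x) \<partial>lborel)"
    by (subst nn_integral_real_affine[where c = "-1" and t = 0]) auto
  also have "\<dots> = (\<integral>\<^sup>+x. ennreal (std_normal_density x) * k (- x) \<partial>lborel)"
    by (simp add: std_normal_density_def)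
  also have "\<dots> = (\<integral>\<^sup>+x. k (- x) \<partial>std_gauss)"
    by (subst nn_integral_std_gauss) auto
  finally show ?thesis ..
qed

lemma nn_integral_tilt: "(\<integral>\<^sup>+x. ennreal (tilt t x) \<partial>std_gauss) = 1"
  using std_gauss_shift[of "\<lambda>_. 1" t] gauss.emeasure_space_1 by simp

text \<open>
  The density \<open>exp (- r\<^sup>2 / 2) cosh (r x)\<close> of the equal mixture of the normal laws shifted by
  \<open>r\<close> and by \<open>- r\<close>.
\<close>

definition sym_tilt :: "real \<Rightarrow> real \<Rightarrow> real" where
  "sym_tilt r x = (tilt r x + tilt (- r) x) / 2"

lemma sym_tilt_measurable [measurable]: "sym_tilt r \<in> borel_measurable borel"
  unfolding sym_tilt_def by measurable

text \<open>
  By reflection \<open>(r + Z)\<^sup>2\<close> and \<open>(- r + Z)\<^sup>2\<close> have the same law, so a shift that is only seen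
  through squares may be symmetrised. The gain is in the second moment of the density: it is
  \<open>cosh (r\<^sup>2)\<close> instead of the \<open>exp (r\<^sup>2)\<close> of the plain shift, and thus has no term of first order in \<open>r\<^sup>2\<close>.
\<close>

lemma std_gauss_sq_shift:
  assumes [measurable]: "k \<in> borel_measurable borel"
  shows "(\<integral>\<^sup>+x. k ((r + x)\<^sup>2) \<partial>std_gauss) = (\<integral>\<^sup>+x. k (x\<^sup>2) * ennreal (sym_tilt r x) \<partial>std_gauss)"
proof -
  have 1: "(\<integral>\<^sup>+x. k ((r + x)\<^sup>2) \<partial>std_gauss) = (\<integral>\<^sup>+x. k (x\<^sup>2) * ennreal (tilt r x) \<partial>std_gauss)"
    by (rule std_gauss_shift[of "\<lambda>x. k (x\<^sup>2)"]) simp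
  also have "\<dots> = (\<integral>\<^sup>+x. k (x\<^sup>2) * ennreal (tilt (- r) x) \<partial>std_gauss)"
    by (subst std_gauss_reflect[symmetric]) (auto simp: tilt_def)
  finally have 2: "(\<integral>\<^sup>+x. k ((r + x)\<^sup>2) \<partial>std_gauss) = (\<integral>\<^sup>+x. k (x\<^sup>2) * ennreal (tilt (- r) x) \<partial>std_gauss)" .
  have h: "ennreal (1/2) + ennreal (1/2) = 1"
    by (subst ennreal_plus[symmetric]) auto
  have "(\<integral>\<^sup>+x. k (x\<^sup>2) * ennreal (sym_tilt r x) \<partial>std_gauss)
     = (\<integral>\<^sup>+x. ennreal (1/2) * (k (x\<^sup>2) * ennreal (tilt r x)) + ennreal (1/2) * (k (x\<^sup>2) * ennreal (tilt (- r) x)) \<partial>std_gauss)"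
  proof (intro nn_integral_cong)
    fix x
    have "ennreal (sym_tilt r x) = ennreal (1/2) * ennreal (tilt r x) + ennreal (1/2) * ennreal (tilt (- r) x)"
      by (subst (1 2) ennreal_mult[symmetric], simp_all, subst ennreal_plus[symmetric])
         (simp_all add: sym_tilt_def add_divide_distrib)
    then show "k (x\<^sup>2) * ennreal (sym_tilt r x) = ennreal (1/2) * (k (x\<^sup>2) * ennreal (tilt r x))
        + ennreal (1/2) * (k (x\<^sup>2) * ennreal (tilt (- r) x))"
      by (simp only: distrib_left mult_ac)
  qed
  also have "\<dots> = ennreal (1/2) * (\<integral>\<^sup>+x. k ((r + x)\<^sup>2) \<partial>std_gauss) + ennreal (1/2) * (\<integral>\<^sup>+x. k ((r + x)\<^sup>2) \<partial>std_gauss)"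
    by (subst nn_integral_add) (auto simp: nn_integral_cmult 1[symmetric] 2[symmetric])
  also have "\<dots> = (\<integral>\<^sup>+x. k ((r + x)\<^sup>2) \<partial>std_gauss)"
    by (simp only: distrib_right[symmetric] h mult_1_left)
  finally show ?thesis ..
qed

lemma integrable_tilt: "integrable std_gauss (tilt t)"
  and integral_tilt: "(\<integral>x. tilt t x \<partial>std_gauss) = 1"
proof -
  have "has_bochner_integral std_gauss (tilt t) 1"
    by (rule has_bochner_integral_nn_integral) (auto simp: nn_integral_tilt)
  then show "integrable std_gauss (tilt t)" "(\<integral>x. tilt t x \<partial>std_gauss) = 1"
    by (auto simp: has_bochner_integral_iff)
qed

lemma tilt_power2: "(tilt t x)\<^sup>2 = exp (t\<^sup>2) * tilt (2 * t) x"
  by (simp add: tilt_def power2_eq_square exp_add[symmetric])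

lemma integrable_tilt_sq: "integrable std_gauss (\<lambda>x. (tilt t x)\<^sup>2)"
  and integral_tilt_sq: "(\<integral>x. (tilt t x)\<^sup>2 \<partial>std_gauss) = exp (t\<^sup>2)"
  unfolding tilt_power2 by (auto simp: integrable_tilt integral_tilt)

lemma sym_tilt_power2:
  "(sym_tilt r x)\<^sup>2 = exp (r\<^sup>2) / 4 * tilt (2 * r) x + exp (r\<^sup>2) / 4 * tilt (- (2 * r)) x + exp (- (r\<^sup>2)) / 2"
proof -
  have "tilt r x * tilt (- r) x = exp (- (r\<^sup>2))"
    by (simp add: tilt_def exp_add[symmetric])
  then show ?thesis
    unfolding sym_tilt_def using tilt_power2[of r x] tilt_power2[of "- r" x]
    by (simp add: power2_eq_square field_simps)
qed

lemma integrable_sym_tilt_sq: "integrable std_gauss (\<lambda>x. (sym_tilt r x)\<^sup>2)"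
  and integral_sym_tilt_sq: "(\<integral>x. (sym_tilt r x)\<^sup>2 \<partial>std_gauss) = cosh (r\<^sup>2)"
  unfolding sym_tilt_power2
  by (auto simp: integrable_tilt integral_tilt gauss.prob_space[simplified] cosh_field_def)

section \<open>Rotation invariance of noncentral chi-square laws\<close>

lemma nn_integral_lborel_shear_snd:
  fixes F :: "real \<Rightarrow> real \<Rightarrow> ennreal"
  assumes F [measurable]: "case_prod F \<in> borel_measurable (borel \<Otimes>\<^sub>M borel)"
  shows "(\<integral>\<^sup>+x. \<integral>\<^sup>+y. F x (y + s * x) \<partial>lborel \<partial>lborel) = (\<integral>\<^sup>+x. \<integral>\<^sup>+y. F x y \<partial>lborel \<partial>lborel)"
proof (rule nn_integral_cong)
  fix x
  show "(\<integral>\<^sup>+y. F x (y + s * x) \<partial>lborel) = (\<integral>\<^sup>+y. F x y \<partial>lborel)"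
    using nn_integral_real_affine[of "F x" 1 "s * x"] by (simp add: add.commute)
qed

lemma nn_integral_lborel_swap:
  fixes F :: "real \<Rightarrow> real \<Rightarrow> ennreal"
  assumes F [measurable]: "case_prod F \<in> borel_measurable (borel \<Otimes>\<^sub>M borel)"
  shows "(\<integral>\<^sup>+x. \<integral>\<^sup>+y. F y x \<partial>lborel \<partial>lborel) = (\<integral>\<^sup>+x. \<integral>\<^sup>+y. F x y \<partial>lborel \<partial>lborel)"
  by (rule lborel_pair.Fubini') simp

lemma nn_integral_lborel_shear_fst:
  fixes F :: "real \<Rightarrow> real \<Rightarrow> ennreal"
  assumes F [measurable]: "case_prod F \<in> borel_measurable (borel \<Otimes>\<^sub>M borel)"
  shows "(\<integral>\<^sup>+x. \<integral>\<^sup>+y. F (x + s * y) y \<partial>lborel \<partial>lborel) = (\<integral>\<^sup>+x. \<integral>\<^sup>+y. F x y \<partial>lborel \<partial>lborel)"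
proof -
  have "(\<integral>\<^sup>+x. \<integral>\<^sup>+y. F (x + s * y) y \<partial>lborel \<partial>lborel) = (\<integral>\<^sup>+x. \<integral>\<^sup>+y. F (y + s * x) x \<partial>lborel \<partial>lborel)"
    by (rule nn_integral_lborel_swap[symmetric]) measurable
  also have "\<dots> = (\<integral>\<^sup>+x. \<integral>\<^sup>+y. F y x \<partial>lborel \<partial>lborel)"
    by (rule nn_integral_lborel_shear_snd) measurable
  also have "\<dots> = (\<integral>\<^sup>+x. \<integral>\<^sup>+y. F x y \<partial>lborel \<partial>lborel)"
    by (rule nn_integral_lborel_swap) measurable
  finally show ?thesis .
qed

text \<open>
  A rotation is a composition of three shears, and a shear preserves the Lebesgue measure because a
  translation of the line does. The parameter \<open>t\<close> below is the tangent of half the angle, which is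
  why the half turn \<open>c = -1\<close> is excluded.
\<close>

lemma nn_integral_lborel_rotate:
  fixes F :: "real \<Rightarrow> real \<Rightarrow> ennreal"
  assumes F [measurable]: "case_prod F \<in> borel_measurable (borel \<Otimes>\<^sub>M borel)"
    and cs: "c\<^sup>2 + s\<^sup>2 = 1" and c: "c \<noteq> -1"
  shows "(\<integral>\<^sup>+x. \<integral>\<^sup>+y. F (c * x - s * y) (s * x + c * y) \<partial>lborel \<partial>lborel) = (\<integral>\<^sup>+x. \<integral>\<^sup>+y. F x y \<partial>lborel \<partial>lborel)"
proof -
  define t where "t = s / (1 + c)"
  have c': "1 + c \<noteq> 0" using c by linarith
  have s: "s = t * (1 + c)" using c' by (simp add: t_def)
  have "s * s = (1 - c) * (1 + c)" using cs by (simp add: power2_eq_square algebra_simps)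
  then have st: "s * t = 1 - c" using c' by (simp add: t_def)
  have eq1: "c * x - s * y = (x + (- t) * y) + (- t) * (y + s * (x + (- t) * y))" for x y
  proof -
    have "(x + (- t) * y) + (- t) * (y + s * (x + (- t) * y)) = x - (s * t) * x - t * y - t * y + (s * t) * (t * y)"
      by (simp add: algebra_simps)
    also have "\<dots> = c * x - (t * (1 + c)) * y" unfolding st by (simp add: algebra_simps)
    finally show ?thesis using s by simp
  qed
  have eq2: "s * x + c * y = y + s * (x + (- t) * y)" for x y
  proof -
    have "y + s * (x + (- t) * y) = s * x + y - (s * t) * y" by (simp add: algebra_simps)
    also have "\<dots> = s * x + c * y" unfolding st by (simp add: algebra_simps)
    finally show ?thesis ..
  qed
  define F1 where "F1 = (\<lambda>x y. F (x + (- t) * y) y)"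
  define F2 where "F2 = (\<lambda>x y. F1 x (y + s * x))"
  have [measurable]: "case_prod F1 \<in> borel_measurable (borel \<Otimes>\<^sub>M borel)"
    unfolding F1_def by measurable
  have [measurable]: "case_prod F2 \<in> borel_measurable (borel \<Otimes>\<^sub>M borel)"
    unfolding F2_def by measurable
  have "(\<integral>\<^sup>+x. \<integral>\<^sup>+y. F (c * x - s * y) (s * x + c * y) \<partial>lborel \<partial>lborel)
      = (\<integral>\<^sup>+x. \<integral>\<^sup>+y. F2 (x + (- t) * y) y \<partial>lborel \<partial>lborel)"
    unfolding F2_def F1_def eq1 eq2 ..
  also have "\<dots> = (\<integral>\<^sup>+x. \<integral>\<^sup>+y. F2 x y \<partial>lborel \<partial>lborel)"
    by (rule nn_integral_lborel_shear_fst) measurable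
  also have "\<dots> = (\<integral>\<^sup>+x. \<integral>\<^sup>+y. F1 x y \<partial>lborel \<partial>lborel)"
    unfolding F2_def by (rule nn_integral_lborel_shear_snd) measurable
  also have "\<dots> = (\<integral>\<^sup>+x. \<integral>\<^sup>+y. F x y \<partial>lborel \<partial>lborel)"
    unfolding F1_def by (rule nn_integral_lborel_shear_fst) measurable
  finally show ?thesis .
qed

text \<open>
  The joint density of two independent normal variables is a function of \<open>x\<^sup>2 + y\<^sup>2\<close>, so the
  rotation that takes the direction of \<open>(p, q)\<close> to the first axis moves the mean to \<open>(r, 0)\<close>. If
  \<open>p = - r\<close>, that rotation is the half turn.
\<close>

lemma std_gauss_rotate:
  fixes h :: "real \<Rightarrow> ennreal"
  assumes [measurable]: "h \<in> borel_measurable borel"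
    and r: "r\<^sup>2 = p\<^sup>2 + q\<^sup>2" and pr: "p \<noteq> - r"
  shows "(\<integral>\<^sup>+x. \<integral>\<^sup>+y. h ((p + x)\<^sup>2 + (q + y)\<^sup>2) \<partial>std_gauss \<partial>std_gauss)
       = (\<integral>\<^sup>+x. \<integral>\<^sup>+y. h ((r + x)\<^sup>2 + (0 + y)\<^sup>2) \<partial>std_gauss \<partial>std_gauss)"
proof -
  have r0: "r \<noteq> 0" using r pr by auto
  define c s where "c = p / r" and "s = q / r"
  have cs: "c\<^sup>2 + s\<^sup>2 = 1" and c: "c \<noteq> -1" and p: "p = c * r" and q: "q = s * r"
    using r0 r pr by (auto simp: c_def s_def power_divide add_divide_distrib[symmetric] field_simps)
  define H where "H p q x y = ennreal (std_normal_density x) * (ennreal (std_normal_density y) * h ((p + x)\<^sup>2 + (q + y)\<^sup>2))"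
    for p q x y
  have H_alt: "H p q x y = ennreal (exp (- (x\<^sup>2 + y\<^sup>2) / 2) / (2 * pi)) * h ((p + x)\<^sup>2 + (q + y)\<^sup>2)" for p q x y
    unfolding H_def mult.assoc[symmetric]
    by (subst ennreal_mult[symmetric])
       (auto simp: std_normal_density_def exp_add[symmetric] add_divide_distrib diff_divide_distrib)
  have [measurable]: "case_prod (H p q) \<in> borel_measurable (borel \<Otimes>\<^sub>M borel)" for p q
    unfolding H_def by measurable
  have lint: "(\<integral>\<^sup>+x. \<integral>\<^sup>+y. h ((p + x)\<^sup>2 + (q + y)\<^sup>2) \<partial>std_gauss \<partial>std_gauss)
    = (\<integral>\<^sup>+x. \<integral>\<^sup>+y. H p q x y \<partial>lborel \<partial>lborel)" for p q
  proof -
    have "(\<integral>\<^sup>+x. \<integral>\<^sup>+y. h ((p + x)\<^sup>2 + (q + y)\<^sup>2) \<partial>std_gauss \<partial>std_gauss)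
      = (\<integral>\<^sup>+x. \<integral>\<^sup>+y. ennreal (std_normal_density y) * h ((p + x)\<^sup>2 + (q + y)\<^sup>2) \<partial>lborel \<partial>std_gauss)"
      by (intro nn_integral_cong nn_integral_std_gauss) measurable
    also have "\<dots> = (\<integral>\<^sup>+x. ennreal (std_normal_density x) *
        (\<integral>\<^sup>+y. ennreal (std_normal_density y) * h ((p + x)\<^sup>2 + (q + y)\<^sup>2) \<partial>lborel) \<partial>lborel)"
      by (intro nn_integral_std_gauss) measurable
    also have "\<dots> = (\<integral>\<^sup>+x. \<integral>\<^sup>+y. H p q x y \<partial>lborel \<partial>lborel)"
      unfolding H_def by (intro nn_integral_cong nn_integral_cmult[symmetric]) measurable
    finally show ?thesis .
  qed
  have sq: "(c * u - s * v)\<^sup>2 + (s * u + c * v)\<^sup>2 = u\<^sup>2 + v\<^sup>2" for u v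
  proof -
    have "(c * u - s * v)\<^sup>2 + (s * u + c * v)\<^sup>2 = (c\<^sup>2 + s\<^sup>2) * (u\<^sup>2 + v\<^sup>2)"
      by (simp add: power2_eq_square algebra_simps)
    then show ?thesis using cs by simp
  qed
  have rot: "H p q (c * x - s * y) (s * x + c * y) = H r 0 x y" for x y
  proof -
    have "p + (c * x - s * y) = c * (r + x) - s * y" "q + (s * x + c * y) = s * (r + x) + c * y"
      by (auto simp: p q algebra_simps)
    then have "(p + (c * x - s * y))\<^sup>2 + (q + (s * x + c * y))\<^sup>2 = (r + x)\<^sup>2 + y\<^sup>2"
      by (simp only: sq)
    then show ?thesis unfolding H_alt sq by simp
  qed
  have "(\<integral>\<^sup>+x. \<integral>\<^sup>+y. H p q x y \<partial>lborel \<partial>lborel) = (\<integral>\<^sup>+x. \<integral>\<^sup>+y. H r 0 x y \<partial>lborel \<partial>lborel)"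
    by (subst nn_integral_lborel_rotate[OF _ cs c, symmetric]) (simp_all only: rot, measurable)
  then show ?thesis unfolding lint .
qed

definition sq_law :: "real \<Rightarrow> real measure" where
  "sq_law p = distr std_gauss borel (\<lambda>x. (p + x)\<^sup>2)"

text \<open>
  The noncentral chi-square law, given by its mean vector.
\<close>

definition sq_norm_law :: "'i set \<Rightarrow> ('i \<Rightarrow> real) \<Rightarrow> real measure" where
  "sq_norm_law J \<theta> = distr (std_gauss_PiM J) borel (\<lambda>z. \<Sum>i\<in>J. (\<theta> i + z i)\<^sup>2)"

lemma sets_sq_law [simp, measurable_cong]: "sets (sq_law p) = sets borel"
  and sets_sq_norm_law [simp, measurable_cong]: "sets (sq_norm_law J \<theta>) = sets borel"
  by (simp_all add: sq_law_def sq_norm_law_def)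

lemma prob_space_std_gauss_PiM: "prob_space (std_gauss_PiM J)"
  by (rule prob_space_PiM) (rule prob_space_std_gauss)

lemma measurable_sq_norm [measurable]:
  "(\<lambda>z. \<Sum>i\<in>J. (\<theta> i + z i)\<^sup>2) \<in> borel_measurable (std_gauss_PiM J)"
proof (rule borel_measurable_sum)
  fix i assume [measurable]: "i \<in> J"
  show "(\<lambda>z. (\<theta> i + z i)\<^sup>2) \<in> borel_measurable (std_gauss_PiM J)"
    by measurable
qed

lemma finite_measure_sq_law [simp]: "finite_measure (sq_law p)"
  unfolding sq_law_def
  by (intro prob_space.finite_measure gauss.prob_space_distr) measurable

lemma prob_space_sq_norm_law: "prob_space (sq_norm_law J \<theta>)"
  unfolding sq_norm_law_def
  by (intro prob_space.prob_space_distr prob_space_std_gauss_PiM) measurable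

lemma finite_measure_sq_norm_law [simp]: "finite_measure (sq_norm_law J \<theta>)"
  by (intro prob_space.finite_measure prob_space_sq_norm_law)

lemma nn_integral_sq_law:
  "h \<in> borel_measurable borel \<Longrightarrow> (\<integral>\<^sup>+x. h x \<partial>sq_law p) = (\<integral>\<^sup>+x. h ((p + x)\<^sup>2) \<partial>std_gauss)"
  unfolding sq_law_def by (subst nn_integral_distr) auto

lemma nn_integral_sq_norm_law:
  "h \<in> borel_measurable borel \<Longrightarrow>
    (\<integral>\<^sup>+x. h x \<partial>sq_norm_law J \<theta>) = (\<integral>\<^sup>+z. h (\<Sum>i\<in>J. (\<theta> i + z i)\<^sup>2) \<partial>std_gauss_PiM J)"
  unfolding sq_norm_law_def by (subst nn_integral_distr) auto

lemma measure_eqI_nn_integral: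
  assumes "sets M = sets borel" "sets N = sets borel"
    and "\<And>h. h \<in> borel_measurable borel \<Longrightarrow> (\<integral>\<^sup>+x. h x \<partial>M) = (\<integral>\<^sup>+x. h x \<partial>N)"
  shows "M = N"
proof (rule measure_eqI)
  show "sets M = sets N" using assms by simp
  fix A assume "A \<in> sets M"
  then show "emeasure M A = emeasure N A"
    using assms(3)[of "indicator A"] assms(1,2) by simp
qed

lemma sq_law_minus: "sq_law (- p) = sq_law p"
proof (rule measure_eqI_nn_integral)
  fix h :: "real \<Rightarrow> ennreal" assume [measurable]: "h \<in> borel_measurable borel"
  show "(\<integral>\<^sup>+x. h x \<partial>sq_law (- p)) = (\<integral>\<^sup>+x. h x \<partial>sq_law p)"
    by (subst (1 2) nn_integral_sq_law, simp_all, subst std_gauss_reflect[symmetric])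
       (auto simp: power2_commute)
qed auto

lemma sq_law_cong: "p\<^sup>2 = q\<^sup>2 \<Longrightarrow> sq_law p = sq_law q"
  by (auto simp: power2_eq_iff sq_law_minus)

lemma sq_law_convolution:
  assumes "r\<^sup>2 = p\<^sup>2 + q\<^sup>2"
  shows "(sq_law p \<star> sq_law q) = (sq_law r \<star> sq_law 0)"
proof -
  have *: "(sq_law p \<star> sq_law q) = (sq_law r \<star> sq_law 0)"
    if r: "r\<^sup>2 = p\<^sup>2 + q\<^sup>2" "p \<noteq> - r" for r
    using std_gauss_rotate[OF _ r]
    by (intro measure_eqI_nn_integral) (auto simp: nn_integral_convolution nn_integral_sq_law)
  show ?thesis
  proof (cases "p = - r")
    case False
    then show ?thesis using * assms by blast
  next
    case True
    then have "q = 0" using assms by simp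
    then show ?thesis using True by (simp only: sq_law_minus)
  qed
qed

lemma sq_norm_law_insert:
  assumes [simp]: "finite J" "i \<notin> J"
  shows "sq_norm_law (insert i J) \<theta> = (sq_law (\<theta> i) \<star> sq_norm_law J \<theta>)"
proof (rule measure_eqI_nn_integral)
  interpret P: prob_space "std_gauss_PiM J"
    by (rule prob_space_std_gauss_PiM)
  fix h :: "real \<Rightarrow> ennreal" assume [measurable]: "h \<in> borel_measurable borel"
  have "(\<integral>\<^sup>+x. h x \<partial>sq_norm_law (insert i J) \<theta>)
      = (\<integral>\<^sup>+x. \<integral>\<^sup>+z. h (\<Sum>l\<in>insert i J. (\<theta> l + (z(i := x)) l)\<^sup>2) \<partial>std_gauss_PiM J \<partial>std_gauss)"
    by (subst nn_integral_sq_norm_law, simp, subst gauss_prod.product_nn_integral_insert_rev) auto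
  also have "\<dots> = (\<integral>\<^sup>+x. \<integral>\<^sup>+z. h ((\<theta> i + x)\<^sup>2 + (\<Sum>l\<in>J. (\<theta> l + z l)\<^sup>2)) \<partial>std_gauss_PiM J \<partial>std_gauss)"
    by (intro nn_integral_cong arg_cong[where f = h])
       (auto intro!: sum.cong)
  also have "\<dots> = (\<integral>\<^sup>+x. h x \<partial>(sq_law (\<theta> i) \<star> sq_norm_law J \<theta>))"
    by (subst nn_integral_convolution)
       (auto simp: nn_integral_sq_law nn_integral_sq_norm_law)
  finally show "(\<integral>\<^sup>+x. h x \<partial>sq_norm_law (insert i J) \<theta>) = (\<integral>\<^sup>+x. h x \<partial>(sq_law (\<theta> i) \<star> sq_norm_law J \<theta>))" .
qed auto

text \<open>
  By induction on the dimension: the law is the convolution of the laws of the squared coordinates,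
  and \<open>sq_law_convolution\<close> moves the mean of one coordinate at a time into a single one.
\<close>

lemma sq_norm_law_insert_canonical:
  assumes "finite J" "i \<notin> J" "a\<^sup>2 = (\<Sum>l\<in>insert i J. (\<theta> l)\<^sup>2)"
  shows "sq_norm_law (insert i J) \<theta> = (sq_law a \<star> sq_norm_law J (\<lambda>_. 0))"
  using assms
proof (induction J arbitrary: i a rule: finite_induct)
  case empty
  then have "sq_law (\<theta> i) = sq_law a" by (intro sq_law_cong) simp
  then show ?case by (subst sq_norm_law_insert) (simp_all add: sq_norm_law_def)
next
  case (insert j J)
  define b where "b = sqrt (\<Sum>l\<in>insert j J. (\<theta> l)\<^sup>2)"
  have b: "b\<^sup>2 = (\<Sum>l\<in>insert j J. (\<theta> l)\<^sup>2)"
    by (simp add: b_def sum_nonneg)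
  have a: "a\<^sup>2 = (\<theta> i)\<^sup>2 + b\<^sup>2"
    using insert b by simp
  have "sq_norm_law (insert i (insert j J)) \<theta> = (sq_law (\<theta> i) \<star> sq_norm_law (insert j J) \<theta>)"
    using insert by (intro sq_norm_law_insert) auto
  also have "\<dots> = (sq_law (\<theta> i) \<star> (sq_law b \<star> sq_norm_law J (\<lambda>_. 0)))"
    using insert.IH[of j b] insert.hyps b by simp
  also have "\<dots> = ((sq_law (\<theta> i) \<star> sq_law b) \<star> sq_norm_law J (\<lambda>_. 0))"
    by (intro convolution_associative) auto
  also have "\<dots> = ((sq_law a \<star> sq_law 0) \<star> sq_norm_law J (\<lambda>_. 0))"
    using sq_law_convolution[OF a] by simp
  also have "\<dots> = (sq_law a \<star> (sq_law 0 \<star> sq_norm_law J (\<lambda>_. 0)))"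
    by (intro convolution_associative[symmetric]) auto
  also have "\<dots> = (sq_law a \<star> sq_norm_law (insert j J) (\<lambda>_. 0))"
    using insert.hyps by (subst sq_norm_law_insert) auto
  finally show ?case .
qed

lemma sq_norm_law_cong:
  assumes J: "finite J" and eq: "(\<Sum>i\<in>J. (\<theta> i)\<^sup>2) = (\<Sum>i\<in>J. (\<theta>' i)\<^sup>2)"
  shows "sq_norm_law J \<theta> = sq_norm_law J \<theta>'"
proof (cases "J = {}")
  case True
  then show ?thesis by (simp add: sq_norm_law_def)
next
  case False
  then obtain i where i: "i \<in> J" by blast
  define a where "a = sqrt (\<Sum>i\<in>J. (\<theta> i)\<^sup>2)"
  have a: "a\<^sup>2 = (\<Sum>i\<in>J. (\<theta> i)\<^sup>2)" by (simp add: a_def sum_nonneg)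
  have J': "J = insert i (J - {i})" using i by blast
  have "sq_norm_law (insert i (J - {i})) \<theta> = sq_norm_law (insert i (J - {i})) \<theta>'"
    using J a eq J' by (subst (1 2) sq_norm_law_insert_canonical[where a = a]) auto
  then show ?thesis using J' by simp
qed

section \<open>Closeness of noncentral chi-square laws\<close>

text \<open>
  If in each coordinate a change of the mean can be undone, as far as the square is concerned, by a
  density \<open>f i\<close>, then in the product space the density is the product of the \<open>f i\<close>. The assumption
  speaks of functions of the square only, which is what admits the symmetrised densities.
\<close>

lemma nn_integral_sq_norm_reweight:
  fixes f :: "'i \<Rightarrow> real \<Rightarrow> real" and h :: "real \<Rightarrow> ennreal"
  assumes J: "finite J"
    and f [measurable]: "\<And>i. f i \<in> borel_measurable borel" and f0: "\<And>i x. 0 \<le> f i x"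
    and fp: "\<And>i k. i \<in> J \<Longrightarrow> k \<in> borel_measurable borel \<Longrightarrow>
      (\<integral>\<^sup>+x. k ((p' i + x)\<^sup>2) \<partial>std_gauss) = (\<integral>\<^sup>+x. k ((p i + x)\<^sup>2) * ennreal (f i x) \<partial>std_gauss)"
    and h: "h \<in> borel_measurable borel"
  shows "(\<integral>\<^sup>+z. h (\<Sum>i\<in>J. (p' i + z i)\<^sup>2) \<partial>std_gauss_PiM J)
       = (\<integral>\<^sup>+z. h (\<Sum>i\<in>J. (p i + z i)\<^sup>2) * ennreal (\<Prod>i\<in>J. f i (z i)) \<partial>std_gauss_PiM J)"
  using J fp h
proof (induction J arbitrary: h rule: finite_induct)
  case empty
  show ?case by simp
next
  case (insert i J)
  note [measurable] = insert.prems(2)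
  interpret P: prob_space "std_gauss_PiM J"
    by (rule prob_space_std_gauss_PiM)
  have [measurable]: "(\<lambda>z. \<Prod>l\<in>K. f l (z l)) \<in> borel_measurable (std_gauss_PiM K)" for K
  proof (rule borel_measurable_prod)
    fix l assume [measurable]: "l \<in> K"
    show "(\<lambda>z. f l (z l)) \<in> borel_measurable (std_gauss_PiM K)" by measurable
  qed
  define K where "K s = (\<integral>\<^sup>+z. h (s + (\<Sum>l\<in>J. (p l + z l)\<^sup>2)) * ennreal (\<Prod>l\<in>J. f l (z l)) \<partial>std_gauss_PiM J)" for s
  have [measurable]: "K \<in> borel_measurable borel"
    unfolding K_def by measurable
  have sums: "(\<Sum>l\<in>insert i J. (q l + (z(i := x)) l)\<^sup>2) = (q i + x)\<^sup>2 + (\<Sum>l\<in>J. (q l + z l)\<^sup>2)" for q z x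
  proof -
    have "(\<Sum>l\<in>J. (q l + (z(i := x)) l)\<^sup>2) = (\<Sum>l\<in>J. (q l + z l)\<^sup>2)"
      using insert.hyps by (intro sum.cong) auto
    then show ?thesis using insert.hyps by simp
  qed
  have prods: "(\<Prod>l\<in>insert i J. f l ((z(i := x)) l)) = (\<Prod>l\<in>J. f l (z l)) * f i x" for z x
  proof -
    have "(\<Prod>l\<in>J. f l ((z(i := x)) l)) = (\<Prod>l\<in>J. f l (z l))"
      using insert.hyps by (intro prod.cong) auto
    then show ?thesis using insert.hyps by (simp add: mult.commute)
  qed
  have "(\<integral>\<^sup>+z. h (\<Sum>l\<in>insert i J. (p' l + z l)\<^sup>2) \<partial>std_gauss_PiM (insert i J))
      = (\<integral>\<^sup>+x. \<integral>\<^sup>+z. h ((p' i + x)\<^sup>2 + (\<Sum>l\<in>J. (p' l + z l)\<^sup>2)) \<partial>std_gauss_PiM J \<partial>std_gauss)"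
    using insert.hyps by (subst gauss_prod.product_nn_integral_insert_rev) (simp_all only: sums, measurable)
  also have "\<dots> = (\<integral>\<^sup>+x. K ((p' i + x)\<^sup>2) \<partial>std_gauss)"
    unfolding K_def by (rule nn_integral_cong, rule insert.IH) (auto intro: insert.prems(1))
  also have "\<dots> = (\<integral>\<^sup>+x. K ((p i + x)\<^sup>2) * ennreal (f i x) \<partial>std_gauss)"
    using insert.prems(1) by simp
  also have "\<dots> = (\<integral>\<^sup>+x. \<integral>\<^sup>+z. h ((p i + x)\<^sup>2 + (\<Sum>l\<in>J. (p l + z l)\<^sup>2)) * ennreal ((\<Prod>l\<in>J. f l (z l)) * f i x) \<partial>std_gauss_PiM J \<partial>std_gauss)"
    unfolding K_def
    by (rule nn_integral_cong, subst nn_integral_multc[symmetric])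
       (auto simp: ennreal_mult f0 prod_nonneg mult_ac)
  also have "\<dots> = (\<integral>\<^sup>+z. h (\<Sum>l\<in>insert i J. (p l + z l)\<^sup>2) * ennreal (\<Prod>l\<in>insert i J. f l (z l)) \<partial>std_gauss_PiM (insert i J))"
    using insert.hyps by (subst gauss_prod.product_nn_integral_insert_rev) (simp_all only: sums prods, measurable)
  finally show ?case .
qed

text \<open>
  For the product density \<open>F\<close>, the two probabilities differ by the integral of \<open>F - 1\<close> over an event,
  hence by at most \<open>E \<bar>F - 1\<bar> \<le> \<surd>E (F - 1)\<^sup>2\<close>. As \<open>E F = 1\<close>, the last expectation is \<open>E F\<^sup>2 - 1\<close>, and
  \<open>E F\<^sup>2\<close> factorises over the coordinates.
\<close>

lemma sq_norm_law_diff_le_chi_square: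
  fixes f :: "'i \<Rightarrow> real \<Rightarrow> real"
  assumes J: "finite J"
    and f [measurable]: "\<And>i. f i \<in> borel_measurable borel" and f0: "\<And>i x. 0 \<le> f i x"
    and f2: "\<And>i. i \<in> J \<Longrightarrow> integrable std_gauss (\<lambda>x. (f i x)\<^sup>2)"
    and fp: "\<And>i k. i \<in> J \<Longrightarrow> k \<in> borel_measurable borel \<Longrightarrow>
      (\<integral>\<^sup>+x. k ((p' i + x)\<^sup>2) \<partial>std_gauss) = (\<integral>\<^sup>+x. k ((p i + x)\<^sup>2) * ennreal (f i x) \<partial>std_gauss)"
    and C [measurable]: "C \<in> sets borel"
  shows "\<bar>measure (sq_norm_law J p') C - measure (sq_norm_law J p) C\<bar>
      \<le> sqrt ((\<Prod>i\<in>J. \<integral>x. (f i x)\<^sup>2 \<partial>std_gauss) - 1)"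
proof -
  let ?P = "std_gauss_PiM J"
  interpret P: prob_space ?P
    by (rule prob_space_std_gauss_PiM)
  define F where "F z = (\<Prod>i\<in>J. f i (z i))" for z
  define S where "S z = (\<Sum>i\<in>J. (p i + z i)\<^sup>2)" for z
  have [measurable]: "S \<in> borel_measurable ?P"
    unfolding S_def by measurable
  have [measurable]: "F \<in> borel_measurable ?P"
    unfolding F_def
  proof (rule borel_measurable_prod)
    fix l assume [measurable]: "l \<in> J"
    show "(\<lambda>z. f l (z l)) \<in> borel_measurable ?P" by measurable
  qed
  have F0: "0 \<le> F z" for z
    by (simp add: F_def prod_nonneg f0)
  have reweight: "(\<integral>\<^sup>+x. h x \<partial>sq_norm_law J p') = (\<integral>\<^sup>+z. h (S z) * ennreal (F z) \<partial>?P)"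
    if "h \<in> borel_measurable borel" for h
    unfolding S_def F_def nn_integral_sq_norm_law[OF that]
    by (rule nn_integral_sq_norm_reweight[OF J f f0 fp that])
  have "(\<integral>\<^sup>+z. ennreal (F z) \<partial>?P) = 1"
    using reweight[of "\<lambda>_. 1"] prob_space.emeasure_space_1[OF prob_space_sq_norm_law, of J p'] by simp
  then have "has_bochner_integral ?P F 1"
    by (intro has_bochner_integral_nn_integral) (auto simp: F0)
  then have F1: "integrable ?P F" "(\<integral>z. F z \<partial>?P) = 1"
    by (auto simp: has_bochner_integral_iff)
  have F_sq: "(F z)\<^sup>2 = (\<Prod>i\<in>J. (f i (z i))\<^sup>2)" for z
    by (simp add: F_def prod_power_distrib)
  have F2: "integrable ?P (\<lambda>z. (F z)\<^sup>2)" "(\<integral>z. (F z)\<^sup>2 \<partial>?P) = (\<Prod>i\<in>J. \<integral>x. (f i x)\<^sup>2 \<partial>std_gauss)"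
    unfolding F_sq
    by (rule gauss_prod.product_integrable_prod[OF J f2], assumption)
       (rule gauss_prod.product_integral_prod[OF J f2], assumption)
  have diff_sq: "(F z - 1)\<^sup>2 = (F z)\<^sup>2 - 2 * F z + 1" for z
    by (simp add: power2_eq_square algebra_simps)
  have G2: "integrable ?P (\<lambda>z. (F z - 1)\<^sup>2)" "(\<integral>z. (F z - 1)\<^sup>2 \<partial>?P) = (\<Prod>i\<in>J. \<integral>x. (f i x)\<^sup>2 \<partial>std_gauss) - 1"
    unfolding diff_sq using F1 F2 by (simp_all add: P.prob_space)
  have G1: "integrable ?P (\<lambda>z. \<bar>F z - 1\<bar>)"
    using F1 by simp
  \<comment> \<open>The Cauchy-Schwarz inequality against a constant is the nonnegativity of the variance.\<close>
  have "0 \<le> P.variance (\<lambda>z. \<bar>F z - 1\<bar>)"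
    by simp
  also have "\<dots> = (\<integral>z. (F z - 1)\<^sup>2 \<partial>?P) - (\<integral>z. \<bar>F z - 1\<bar> \<partial>?P)\<^sup>2"
    using G1 G2(1) by (subst P.variance_eq) auto
  finally have l1: "(\<integral>z. \<bar>F z - 1\<bar> \<partial>?P) \<le> sqrt ((\<Prod>i\<in>J. \<integral>x. (f i x)\<^sup>2 \<partial>std_gauss) - 1)"
    unfolding G2(2) by (intro real_le_rsqrt) simp
  have m': "measure (sq_norm_law J p') C = (\<integral>z. indicator C (S z) * F z \<partial>?P)"
  proof -
    have "emeasure (sq_norm_law J p') C = (\<integral>\<^sup>+z. indicator C (S z) * ennreal (F z) \<partial>?P)"
      using reweight[of "indicator C"] by simp
    also have "\<dots> = (\<integral>\<^sup>+z. ennreal (indicator C (S z) * F z) \<partial>?P)"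
      by (intro nn_integral_cong) (auto simp: indicator_def)
    finally show ?thesis
      unfolding measure_def by (subst integral_eq_nn_integral) (auto simp: F0)
  qed
  have m: "measure (sq_norm_law J p) C = (\<integral>z. indicator C (S z) \<partial>?P)"
  proof -
    have "measure (sq_norm_law J p) C = measure ?P (S -` C \<inter> space ?P)"
      unfolding sq_norm_law_def S_def by (subst measure_distr) auto
    also have "\<dots> = (\<integral>z. indicator (S -` C \<inter> space ?P) z \<partial>?P)"
      by simp
    also have "\<dots> = (\<integral>z. indicator C (S z) \<partial>?P)"
      by (intro Bochner_Integration.integral_cong) (auto simp: indicator_def)
    finally show ?thesis .
  qed
  have ind: "integrable ?P (\<lambda>z. indicator C (S z) * F z)" "integrable ?P (\<lambda>z. indicator C (S z) :: real)"
     apply (rule Bochner_Integration.integrable_bound[OF F1(1)])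
      apply (auto simp: indicator_def F0)[2]
    apply (rule P.integrable_const_bound[where B = 1])
     apply auto
    done
  have "\<bar>measure (sq_norm_law J p') C - measure (sq_norm_law J p) C\<bar>
      = \<bar>\<integral>z. indicator C (S z) * F z - indicator C (S z) \<partial>?P\<bar>"
    unfolding m m' using ind by (subst Bochner_Integration.integral_diff) auto
  also have "\<dots> \<le> (\<integral>z. \<bar>F z - 1\<bar> \<partial>?P)"
    by (rule order_trans[OF integral_abs_bound], rule integral_mono)
       (use ind G1 in \<open>auto simp: indicator_def\<close>)
  finally show ?thesis using l1 by linarith
qed

lemma cosh_le_exp_sq:
  assumes "0 \<le> x" "x \<le> (1::real)"
  shows "cosh x \<le> exp (x\<^sup>2)"
proof -
  have "1 \<le> (1 + x) * (1 - x + x\<^sup>2)"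
    using assms by (simp add: algebra_simps power2_eq_square)
  also have "\<dots> \<le> exp x * (1 - x + x\<^sup>2)"
    using assms by (intro mult_right_mono exp_ge_add_one_self) auto
  finally have "exp (- x) \<le> 1 - x + x\<^sup>2"
    by (simp add: exp_minus field_simps)
  then have "cosh x \<le> 1 + x\<^sup>2"
    using exp_bound[OF assms] by (simp add: cosh_field_def)
  also have "\<dots> \<le> exp (x\<^sup>2)" by (rule exp_ge_add_one_self)
  finally show ?thesis .
qed

text \<open>
  In dimension one the larger mean \<open>\<bar>\<theta>'\<bar>\<close> is a shift of the smaller mean \<open>\<bar>\<theta>\<bar>\<close> by \<open>t\<close> with
  \<open>t\<^sup>2 \<le> \<theta>'\<^sup>2 - \<theta>\<^sup>2\<close>. In higher dimension the difference of the squared lengths is spread evenly over all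
  coordinates but \<open>j\<close>, which makes the symmetrised densities so flat that the product of their second
  moments stays bounded although the number of factors grows. In both cases the product of the second
  moments is at most \<open>5/4\<close>.
\<close>

lemma sq_norm_law_close_ordered:
  assumes J: "finite J" "J \<noteq> {}" and C: "C \<in> sets borel"
    and le: "(\<Sum>i\<in>J. (\<theta> i)\<^sup>2) \<le> (\<Sum>i\<in>J. (\<theta>' i)\<^sup>2)"
    and close: "(\<Sum>i\<in>J. (\<theta>' i)\<^sup>2) - (\<Sum>i\<in>J. (\<theta> i)\<^sup>2) \<le> sqrt (real (card J)) / 5"
  shows "\<bar>measure (sq_norm_law J \<theta>') C - measure (sq_norm_law J \<theta>) C\<bar> \<le> 1 / 2"
proof -
  obtain j where j: "j \<in> J" using J by blast
  define \<Delta> where "\<Delta> = (\<Sum>i\<in>J. (\<theta>' i)\<^sup>2) - (\<Sum>i\<in>J. (\<theta> i)\<^sup>2)"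
  have \<Delta>: "0 \<le> \<Delta>" "\<Delta> \<le> sqrt (real (card J)) / 5"
    using le close by (auto simp: \<Delta>_def)
  define n where "n = card (J - {j})"
  have cardJ: "card J = Suc n"
    unfolding n_def using card.remove[OF J(1) j] by simp
  have conclude: ?thesis
    if eq: "sq_norm_law J \<theta> = sq_norm_law J p" "sq_norm_law J \<theta>' = sq_norm_law J p'"
    and bound: "\<bar>measure (sq_norm_law J p') C - measure (sq_norm_law J p) C\<bar> \<le> sqrt (X - 1)" and X: "X \<le> 5 / 4"
    for p p' X
  proof -
    have "sqrt (X - 1) \<le> sqrt ((1/2)\<^sup>2)"
      using X by (intro real_sqrt_le_mono) (simp add: power2_eq_square)
    then show ?thesis using bound unfolding eq by simp
  qed
  show ?thesis
  proof (cases "n = 0")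
    case True
    then have Jj: "J = {j}" using cardJ j by (auto simp: card_1_singleton_iff)
    define t where "t = \<bar>\<theta>' j\<bar> - \<bar>\<theta> j\<bar>"
    have "\<bar>\<theta> j\<bar> \<le> \<bar>\<theta>' j\<bar>"
      using le by (simp add: Jj abs_le_square_iff)
    then have "t * t \<le> t * (\<bar>\<theta>' j\<bar> + \<bar>\<theta> j\<bar>)"
      by (intro mult_left_mono) (auto simp: t_def)
    also have "\<dots> = \<Delta>"
      unfolding t_def \<Delta>_def Jj by (simp add: algebra_simps power2_eq_square)
    finally have t: "t\<^sup>2 \<le> 1 / 5"
      using \<Delta> by (simp add: cardJ True power2_eq_square)
    have "exp (t\<^sup>2) \<le> exp (1 / 5)" using t by simp
    also have "\<dots> \<le> 5 / 4"
      using exp_bound[of "1/5"] by (simp add: power2_eq_square)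
    finally have X: "exp (t\<^sup>2) \<le> 5 / 4" .
    show ?thesis
    proof (rule conclude[OF _ _ _ X])
      show "sq_norm_law J \<theta> = sq_norm_law J (\<lambda>i. \<bar>\<theta> i\<bar>)" "sq_norm_law J \<theta>' = sq_norm_law J (\<lambda>i. \<bar>\<theta>' i\<bar>)"
        using J by (auto intro!: sq_norm_law_cong)
      have "\<bar>measure (sq_norm_law J (\<lambda>i. \<bar>\<theta>' i\<bar>)) C - measure (sq_norm_law J (\<lambda>i. \<bar>\<theta> i\<bar>)) C\<bar>
         \<le> sqrt ((\<Prod>i\<in>J. \<integral>x. (tilt t x)\<^sup>2 \<partial>std_gauss) - 1)"
      proof (rule sq_norm_law_diff_le_chi_square)
        fix i and k :: "real \<Rightarrow> ennreal" assume i: "i \<in> J" and [measurable]: "k \<in> borel_measurable borel"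
        have "\<bar>\<theta>' i\<bar> = \<bar>\<theta> i\<bar> + t" using i by (simp add: Jj t_def)
        then show "(\<integral>\<^sup>+x. k ((\<bar>\<theta>' i\<bar> + x)\<^sup>2) \<partial>std_gauss) = (\<integral>\<^sup>+x. k ((\<bar>\<theta> i\<bar> + x)\<^sup>2) * ennreal (tilt t x) \<partial>std_gauss)"
          using std_gauss_shift[of "\<lambda>x. k ((\<bar>\<theta> i\<bar> + x)\<^sup>2)" t] by (simp add: add.assoc)
      qed (use J C integrable_tilt_sq in auto)
      then show "\<bar>measure (sq_norm_law J (\<lambda>i. \<bar>\<theta>' i\<bar>)) C - measure (sq_norm_law J (\<lambda>i. \<bar>\<theta> i\<bar>)) C\<bar>
         \<le> sqrt (exp (t\<^sup>2) - 1)"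
        by (simp add: Jj integral_tilt_sq)
    qed
  next
    case False
    define a where "a = sqrt (\<Sum>i\<in>J. (\<theta> i)\<^sup>2)"
    have a: "a\<^sup>2 = (\<Sum>i\<in>J. (\<theta> i)\<^sup>2)" by (simp add: a_def sum_nonneg)
    define r where "r = sqrt (\<Delta> / real n)"
    have r: "r\<^sup>2 = \<Delta> / real n" using \<Delta> by (simp add: r_def)
    have "\<Delta>\<^sup>2 \<le> (sqrt (real (card J)) / 5)\<^sup>2"
      using \<Delta> by (intro power_mono) auto
    also have "\<dots> = (real n + 1) / 25"
      by (simp add: cardJ power_divide)
    \<comment> \<open>There are only \<open>n = card J - 1\<close> free coordinates; this costs a factor \<open>2\<close>.\<close>
    also have "\<dots> \<le> 2 * real n / 25" using False by simp
    finally have \<Delta>2: "\<Delta>\<^sup>2 \<le> 2 * real n / 25" .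
    have "(r\<^sup>2)\<^sup>2 \<le> 2 * real n / 25 / (real n)\<^sup>2"
      unfolding r power_divide using \<Delta>2 by (intro divide_right_mono) auto
    also have "\<dots> = 2 / 25 / real n" using False by (simp add: power2_eq_square)
    finally have r4: "(r\<^sup>2)\<^sup>2 \<le> 2 / 25 / real n" .
    also have "\<dots> \<le> 1\<^sup>2" using False by (simp add: field_simps)
    finally have r1: "r\<^sup>2 \<le> 1"
      by (rule power2_le_imp_le) simp
    have "cosh (r\<^sup>2) ^ n \<le> exp ((r\<^sup>2)\<^sup>2) ^ n"
      using r1 by (intro power_mono cosh_le_exp_sq) auto
    also have "\<dots> = exp (real n * (r\<^sup>2)\<^sup>2)" by (simp add: exp_of_nat_mult)
    also have "\<dots> \<le> exp (2 / 25)"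
      using r4 False by (simp add: field_simps)
    also have "\<dots> \<le> 5 / 4"
      using exp_bound[of "2/25"] by (simp add: power2_eq_square)
    finally have X: "cosh (r\<^sup>2) ^ n \<le> 5 / 4" .
    define p p' where "p i = (if i = j then a else 0)" and "p' i = (if i = j then a else r)" for i
    define f where "f i = (if i = j then (\<lambda>_. 1) else sym_tilt r)" for i
    have split: "(\<Sum>i\<in>J. g i) = g j + (\<Sum>i\<in>J - {j}. g i)" for g :: "'a \<Rightarrow> real"
      using J j by (simp add: sum.remove)
    show ?thesis
    proof (rule conclude[OF _ _ _ X])
      have "(\<Sum>i\<in>J. (p i)\<^sup>2) = a\<^sup>2" unfolding split by (simp add: p_def)
      then show "sq_norm_law J \<theta> = sq_norm_law J p"
        using J by (intro sq_norm_law_cong) (auto simp: a)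
      have "(\<Sum>i\<in>J. (p' i)\<^sup>2) = a\<^sup>2 + real n * r\<^sup>2"
        unfolding split by (simp add: p'_def n_def)
      also have "\<dots> = (\<Sum>i\<in>J. (\<theta>' i)\<^sup>2)"
        unfolding r a using False by (simp add: \<Delta>_def)
      finally show "sq_norm_law J \<theta>' = sq_norm_law J p'"
        using J by (intro sq_norm_law_cong) auto
      have "\<bar>measure (sq_norm_law J p') C - measure (sq_norm_law J p) C\<bar>
         \<le> sqrt ((\<Prod>i\<in>J. \<integral>x. (f i x)\<^sup>2 \<partial>std_gauss) - 1)"
      proof (rule sq_norm_law_diff_le_chi_square)
        fix i and k :: "real \<Rightarrow> ennreal" assume i: "i \<in> J" and [measurable]: "k \<in> borel_measurable borel"
        show "(\<integral>\<^sup>+x. k ((p' i + x)\<^sup>2) \<partial>std_gauss) = (\<integral>\<^sup>+x. k ((p i + x)\<^sup>2) * ennreal (f i x) \<partial>std_gauss)"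
          using std_gauss_sq_shift[of k r] by (auto simp: p_def p'_def f_def)
      qed (use J C integrable_sym_tilt_sq in \<open>auto simp: f_def sym_tilt_def\<close>)
      also have "(\<Prod>i\<in>J. \<integral>x. (f i x)\<^sup>2 \<partial>std_gauss) = cosh (r\<^sup>2) ^ n"
        using J j by (simp add: prod.remove f_def integral_sym_tilt_sq n_def gauss.prob_space[simplified])
      finally show "\<bar>measure (sq_norm_law J p') C - measure (sq_norm_law J p) C\<bar> \<le> sqrt (cosh (r\<^sup>2) ^ n - 1)" .
    qed
  qed
qed

lemma sq_norm_law_close:
  assumes J: "finite J" "J \<noteq> {}" and C: "C \<in> sets borel"
    and close: "\<bar>(\<Sum>i\<in>J. (\<theta>' i)\<^sup>2) - (\<Sum>i\<in>J. (\<theta> i)\<^sup>2)\<bar> \<le> sqrt (real (card J)) / 5"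
  shows "\<bar>measure (sq_norm_law J \<theta>') C - measure (sq_norm_law J \<theta>) C\<bar> \<le> 1 / 2"
proof (cases "(\<Sum>i\<in>J. (\<theta> i)\<^sup>2) \<le> (\<Sum>i\<in>J. (\<theta>' i)\<^sup>2)")
  case True
  then show ?thesis using sq_norm_law_close_ordered[OF J C, of \<theta> \<theta>'] close by auto
next
  case False
  then show ?thesis using sq_norm_law_close_ordered[OF J C, of \<theta>' \<theta>] close by (auto simp: abs_minus_commute)
qed

section \<open>Events of the residual filtration under two signals\<close>

text \<open>
  The observation on the canonical space, where the coordinates are the noise.
\<close>

abbreviation canonical_observation ::
    "nat \<Rightarrow> real \<Rightarrow> (nat \<Rightarrow> real) \<Rightarrow> (nat \<Rightarrow> real) \<Rightarrow> (nat \<Rightarrow> real) \<Rightarrow> nat \<Rightarrow> real" where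
  "canonical_observation D \<delta> lam \<equiv> observation D \<delta> lam (\<lambda>i z. z i)"

lemma space_residual_filtration [simp]: "space (residual_filtration D m) = data_space D"
  by (simp add: residual_filtration_def space_measure_of_conv)

lemma space_PiM_data: "space (PiM {1..D} (\<lambda>_. borel :: real measure)) = data_space D"
  by (simp add: space_PiM data_space_def)

lemma space_std_gauss_PiM: "space (std_gauss_PiM J) = J \<rightarrow>\<^sub>E UNIV"
  by (simp add: space_PiM)

lemma L2_set_sq: "(L2_set f J)\<^sup>2 = (\<Sum>i\<in>J. (f i)\<^sup>2)"
  by (simp add: L2_set_def sum_nonneg)

lemma sets_residual_filtration_subset:
  assumes gen: "sigma_algebra (data_space D) \<S>"
    and coord: "\<And>i A. i \<in> {1..min m D} \<Longrightarrow> A \<in> sets borel \<Longrightarrow> (\<lambda>y. y i) -` A \<inter> data_space D \<in> \<S>"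
    and norm: "\<And>A. A \<in> sets borel \<Longrightarrow> (\<lambda>y. (L2_set y {1..D})\<^sup>2) -` A \<inter> data_space D \<in> \<S>"
  shows "sets (residual_filtration D m) \<subseteq> \<S>"
  unfolding residual_filtration_def
  using coord norm by (subst sets_measure_of, blast, intro sigma_algebra.sigma_sets_subset[OF gen]) blast

lemma borel_measurable_component_sq_sum [measurable]:
  "(\<lambda>y. \<Sum>i\<in>J. (y i)\<^sup>2) \<in> borel_measurable (PiM J (\<lambda>_. borel :: real measure))"
proof (rule borel_measurable_sum)
  fix i assume [measurable]: "i \<in> J"
  show "(\<lambda>y. (y i)\<^sup>2) \<in> borel_measurable (PiM J (\<lambda>_. borel :: real measure))" by measurable
qed

lemma residual_filtration_imp_borel:
  assumes "A \<in> sets (residual_filtration D m)"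
  shows "A \<in> sets (PiM {1..D} (\<lambda>_. borel))"
proof -
  have "sets (residual_filtration D m) \<subseteq> sets (PiM {1..D} (\<lambda>_. borel))"
  proof (rule sets_residual_filtration_subset)
    show "sigma_algebra (data_space D) (sets (PiM {1..D} (\<lambda>_. borel :: real measure)))"
      using sets.sigma_algebra_axioms[of "PiM {1..D} (\<lambda>_. borel :: real measure)"]
      by (simp only: space_PiM_data)
    fix A :: "real set" assume [measurable]: "A \<in> sets borel"
    show "(\<lambda>y. (L2_set y {1..D})\<^sup>2) -` A \<inter> data_space D \<in> sets (PiM {1..D} (\<lambda>_. borel))"
      unfolding L2_set_sq
      using measurable_sets[OF borel_measurable_component_sq_sum, of A "{1..D}"]
      unfolding space_PiM_data by simp
    fix i assume i: "i \<in> {1..min m D}"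
    have "(\<lambda>y. y i) \<in> borel_measurable (PiM {1..D} (\<lambda>_. borel :: real measure))"
      using i by (intro measurable_component_singleton) auto
    from measurable_sets[OF this, of A, unfolded space_PiM_data]
    show "(\<lambda>y. y i) -` A \<inter> data_space D \<in> sets (PiM {1..D} (\<lambda>_. borel))"
      by simp
  qed
  then show ?thesis using assms by blast
qed

text \<open>
  An event of the residual filtration at time \<open>m\<close> is determined by the first \<open>m\<close> coordinates and the
  squared norm, and measurably so: the filtration is generated by this pair of statistics, so that each
  of its events is a preimage under the pair.
\<close>

lemma residual_filtration_factor:
  assumes A: "A \<in> sets (residual_filtration D m)" and m: "m \<le> D"
  obtains B where "B \<in> sets (PiM {1..m} (\<lambda>_. borel) \<Otimes>\<^sub>M borel)"
    and "\<And>y. y \<in> data_space D \<Longrightarrow> y \<in> A \<longleftrightarrow> (restrict y {1..m}, \<Sum>i\<in>{1..D}. (y i)\<^sup>2) \<in> B"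
proof -
  let ?N = "PiM {1..m} (\<lambda>_. borel :: real measure) \<Otimes>\<^sub>M (borel :: real measure)"
  define T where "T y = (restrict y {1..m}, \<Sum>i\<in>{1..D}. (y i)\<^sup>2)" for y :: "nat \<Rightarrow> real"
  have T: "T \<in> data_space D \<rightarrow> space ?N"
    by (auto simp: T_def space_pair_measure space_PiM)
  have "sets (residual_filtration D m) \<subseteq> sets (vimage_algebra (data_space D) T ?N)"
  proof (rule sets_residual_filtration_subset)
    show "sigma_algebra (data_space D) (sets (vimage_algebra (data_space D) T ?N))"
      using sets.sigma_algebra_axioms[of "vimage_algebra (data_space D) T ?N"] by simp
    fix A :: "real set" assume [measurable]: "A \<in> sets borel"
    have "snd -` A \<inter> space ?N \<in> sets ?N"
      by measurable
    from in_vimage_algebra[OF this, of T "data_space D"]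
    show "(\<lambda>y. (L2_set y {1..D})\<^sup>2) -` A \<inter> data_space D \<in> sets (vimage_algebra (data_space D) T ?N)"
      by (rule back_subst[where P = "\<lambda>S. S \<in> _"])
         (use T in \<open>auto simp: T_def L2_set_sq\<close>)
    fix i assume i: "i \<in> {1..min m D}"
    then have [measurable]: "i \<in> {1..m}" by auto
    have "(\<lambda>p. fst p i) -` A \<inter> space ?N \<in> sets ?N"
      by measurable
    from in_vimage_algebra[OF this, of T "data_space D"]
    show "(\<lambda>y. y i) -` A \<inter> data_space D \<in> sets (vimage_algebra (data_space D) T ?N)"
      by (rule back_subst[where P = "\<lambda>S. S \<in> _"])
         (use T i in \<open>auto simp: T_def\<close>)
  qed
  with A obtain B where "B \<in> sets ?N" "A = T -` B \<inter> data_space D"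
    unfolding sets_vimage_algebra2[OF T] by blast
  then show thesis by (intro that[of B]) (auto simp: T_def)
qed

lemma measurable_canonical_observation [measurable]:
  "canonical_observation D \<delta> lam \<mu> \<in> std_gauss_PiM {1..D} \<rightarrow>\<^sub>M PiM {1..D} (\<lambda>_. borel)"
  unfolding observation_def
proof (rule measurable_restrict)
  fix i assume [measurable]: "i \<in> {1..D}"
  show "(\<lambda>z. lam i * \<mu> i + \<delta> * z i) \<in> borel_measurable (std_gauss_PiM {1..D})" by measurable
qed

lemma canonical_observation_in_data_space [simp]: "canonical_observation D \<delta> lam \<mu> z \<in> data_space D"
  by (simp add: observation_def data_space_def)

definition obs_prob ::
    "nat \<Rightarrow> real \<Rightarrow> (nat \<Rightarrow> real) \<Rightarrow> (nat \<Rightarrow> real) \<Rightarrow> (nat \<Rightarrow> real) set \<Rightarrow> real" where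
  "obs_prob D \<delta> lam \<mu> A =
     measure (distr (std_gauss_PiM {1..D}) (PiM {1..D} (\<lambda>_. borel)) (canonical_observation D \<delta> lam \<mu>)) A"

text \<open>
  Given the first \<open>m\<close> coordinates \<open>x\<close> of the noise, which produce the same data \<open>u x\<close> under both
  signals, an event of time \<open>m\<close> becomes an event \<open>Cx x\<close> for the squared norm of the remaining
  coordinates of the data, divided by \<open>\<delta>\<^sup>2\<close>. This is a noncentral chi-square variable with \<open>D - m\<close>
  degrees of freedom and the squared weak bias, divided by \<open>\<delta>\<^sup>2\<close>, as its noncentrality. Thus
  \<open>sq_norm_law_close\<close> applies for every \<open>x\<close>, and Fubini's theorem gives the claim.
\<close>

lemma obs_prob_le_add_half:
  assumes A: "A \<in> sets (residual_filtration D m)" and m: "m < D" and \<delta>: "0 < \<delta>"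
    and agree: "\<And>i. i \<in> {1..m} \<Longrightarrow> \<mu> i = \<mu>' i"
    and close: "\<bar>weak_bias_sq D lam m \<mu>' - weak_bias_sq D lam m \<mu>\<bar> \<le> sqrt (real (D - m)) / 5 * \<delta>\<^sup>2"
  shows "obs_prob D \<delta> lam \<mu> A \<le> obs_prob D \<delta> lam \<mu>' A + 1 / 2"
proof -
  define I J where "I = {1..m}" and "J = {m+1..D}"
  have IJ: "I \<inter> J = {}" "finite I" "finite J" "{1..D} = I \<union> J" "J \<noteq> {}" "card J = D - m"
    using m by (auto simp: I_def J_def)
  obtain B where B [measurable]: "B \<in> sets (PiM I (\<lambda>_. borel) \<Otimes>\<^sub>M borel)"
    and AB: "\<And>y. y \<in> data_space D \<Longrightarrow> y \<in> A \<longleftrightarrow> (restrict y I, \<Sum>i\<in>{1..D}. (y i)\<^sup>2) \<in> B"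
    using residual_filtration_factor[OF A] m unfolding I_def by (metis less_imp_le)
  let ?P = "std_gauss_PiM (I \<union> J)" and ?PI = "std_gauss_PiM I" and ?PJ = "std_gauss_PiM J"
  interpret P: prob_space ?P by (rule prob_space_std_gauss_PiM)
  interpret PI: prob_space ?PI by (rule prob_space_std_gauss_PiM)
  have A' [measurable]: "A \<in> sets (PiM (I \<union> J) (\<lambda>_. borel))"
    using residual_filtration_imp_borel[OF A] unfolding IJ(4) .
  define E where "E \<nu> = canonical_observation D \<delta> lam \<nu> -` A \<inter> space ?P" for \<nu>
  have E [measurable]: "E \<nu> \<in> sets ?P" for \<nu>
    unfolding E_def using measurable_sets[OF measurable_canonical_observation residual_filtration_imp_borel[OF A]]
    unfolding IJ(4) .
  have prob_E: "ennreal (obs_prob D \<delta> lam \<nu> A) = emeasure ?P (E \<nu>)" for \<nu>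
    unfolding obs_prob_def E_def
    by (subst measure_distr[OF measurable_canonical_observation residual_filtration_imp_borel[OF A]])
       (simp only: IJ(4) P.emeasure_eq_measure)
  define \<theta> where "\<theta> \<nu> i = lam i * \<nu> i / \<delta>" for \<nu> i
  define u where "u x = (\<lambda>i\<in>I. lam i * \<mu> i + \<delta> * x i)" for x
  define Cx where "Cx x = {t. (u x, (\<Sum>i\<in>I. (u x i)\<^sup>2) + \<delta>\<^sup>2 * t) \<in> B}" for x
  have Cx [measurable]: "Cx x \<in> sets borel" for x
  proof -
    have [measurable]: "u x \<in> space (PiM I (\<lambda>_. borel))"
      by (auto simp: u_def space_PiM)
    have "(\<lambda>t. (u x, (\<Sum>i\<in>I. (u x i)\<^sup>2) + \<delta>\<^sup>2 * t)) -` B \<inter> space borel \<in> sets borel"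
      by measurable
    then show ?thesis by (simp add: Cx_def vimage_def)
  qed
  have slice: "emeasure ?PJ ((\<lambda>y. merge I J (x, y)) -` E \<nu> \<inter> space ?PJ) = emeasure (sq_norm_law J (\<theta> \<nu>)) (Cx x)"
    if \<nu>: "\<And>i. i \<in> I \<Longrightarrow> \<nu> i = \<mu> i" and x: "x \<in> space ?PI" for \<nu> x
  proof -
    have "merge I J (x, y) \<in> E \<nu> \<longleftrightarrow> (\<Sum>i\<in>J. (\<theta> \<nu> i + y i)\<^sup>2) \<in> Cx x" if y: "y \<in> space ?PJ" for y
    proof -
      define w where "w = canonical_observation D \<delta> lam \<nu> (merge I J (x, y))"
      have w: "w i = lam i * \<nu> i + \<delta> * x i" if "i \<in> I" for i
      proof -
        have "i \<in> {1..D}" using that unfolding IJ(4) by simp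
        then show ?thesis using that IJ(1) by (auto simp: w_def observation_def)
      qed
      have w': "w i = \<delta> * (\<theta> \<nu> i + y i)" if "i \<in> J" for i
      proof -
        have "i \<in> {1..D}" using that unfolding IJ(4) by simp
        then show ?thesis using that IJ(1) \<delta> by (auto simp: w_def observation_def \<theta>_def field_simps)
      qed
      have "merge I J (x, y) \<in> space ?P"
        using x y by (auto simp: space_std_gauss_PiM merge_def PiE_def extensional_def)
      then have "merge I J (x, y) \<in> E \<nu> \<longleftrightarrow> w \<in> A"
        by (simp add: E_def w_def)
      also have "\<dots> \<longleftrightarrow> (restrict w I, \<Sum>i\<in>I \<union> J. (w i)\<^sup>2) \<in> B"
        using AB[of w] by (simp add: w_def IJ(4)[symmetric])
      also have "restrict w I = u x"
        using w \<nu> by (auto simp: u_def)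
      also have "(\<Sum>i\<in>I \<union> J. (w i)\<^sup>2) = (\<Sum>i\<in>I. (w i)\<^sup>2) + (\<Sum>i\<in>J. (w i)\<^sup>2)"
        using IJ by (intro sum.union_disjoint) auto
      also have "(\<Sum>i\<in>I. (w i)\<^sup>2) = (\<Sum>i\<in>I. (u x i)\<^sup>2)"
        using w \<nu> by (intro sum.cong) (auto simp: u_def)
      also have "(\<Sum>i\<in>J. (w i)\<^sup>2) = \<delta>\<^sup>2 * (\<Sum>i\<in>J. (\<theta> \<nu> i + y i)\<^sup>2)"
        using w' by (simp add: sum_distrib_left power_mult_distrib)
      finally show ?thesis by (simp add: Cx_def)
    qed
    then have "(\<lambda>y. merge I J (x, y)) -` E \<nu> \<inter> space ?PJ = (\<lambda>y. \<Sum>i\<in>J. (\<theta> \<nu> i + y i)\<^sup>2) -` Cx x \<inter> space ?PJ"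
      by auto
    then show ?thesis
      unfolding sq_norm_law_def by (subst emeasure_distr) auto
  qed
  have fold: "emeasure ?P (E \<nu>) = (\<integral>\<^sup>+x. emeasure (sq_norm_law J (\<theta> \<nu>)) (Cx x) \<partial>?PI)"
    and fold_meas: "(\<lambda>x. emeasure (sq_norm_law J (\<theta> \<nu>)) (Cx x)) \<in> borel_measurable ?PI"
    if \<nu>: "\<And>i. i \<in> I \<Longrightarrow> \<nu> i = \<mu> i" for \<nu>
  proof -
    show "emeasure ?P (E \<nu>) = (\<integral>\<^sup>+x. emeasure (sq_norm_law J (\<theta> \<nu>)) (Cx x) \<partial>?PI)"
      unfolding gauss_prod.emeasure_fold_integral[OF IJ(1-3) E]
      by (intro nn_integral_cong slice[OF \<nu>])
    have "(\<lambda>x. emeasure ?PJ ((\<lambda>y. merge I J (x, y)) -` E \<nu> \<inter> space ?PJ)) \<in> borel_measurable ?PI"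
      by (rule gauss_prod.emeasure_fold_measurable[OF IJ(1-3) E])
    then show "(\<lambda>x. emeasure (sq_norm_law J (\<theta> \<nu>)) (Cx x)) \<in> borel_measurable ?PI"
      by (subst (asm) measurable_cong[OF slice[OF \<nu>]])
  qed
  have wb: "weak_bias_sq D lam m \<nu> = \<delta>\<^sup>2 * (\<Sum>i\<in>J. (\<theta> \<nu> i)\<^sup>2)" for \<nu>
    using \<delta> by (simp add: weak_bias_sq_def J_def \<theta>_def sum_distrib_left power_mult_distrib power_divide)
  have "\<bar>(\<Sum>i\<in>J. (\<theta> \<mu> i)\<^sup>2) - (\<Sum>i\<in>J. (\<theta> \<mu>' i)\<^sup>2)\<bar> * \<delta>\<^sup>2 = \<bar>weak_bias_sq D lam m \<mu>' - weak_bias_sq D lam m \<mu>\<bar>"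
    unfolding wb right_diff_distrib[symmetric] by (simp add: abs_mult abs_minus_commute)
  also note close
  finally have cl: "\<bar>(\<Sum>i\<in>J. (\<theta> \<mu> i)\<^sup>2) - (\<Sum>i\<in>J. (\<theta> \<mu>' i)\<^sup>2)\<bar> \<le> sqrt (real (card J)) / 5"
    using \<delta> IJ(6) by simp
  have pointwise: "emeasure (sq_norm_law J (\<theta> \<mu>)) (Cx x) \<le> emeasure (sq_norm_law J (\<theta> \<mu>')) (Cx x) + ennreal (1 / 2)" for x
  proof -
    interpret L: prob_space "sq_norm_law J (\<theta> \<mu>)" by (rule prob_space_sq_norm_law)
    interpret L': prob_space "sq_norm_law J (\<theta> \<mu>')" by (rule prob_space_sq_norm_law)
    have "measure (sq_norm_law J (\<theta> \<mu>)) (Cx x) \<le> measure (sq_norm_law J (\<theta> \<mu>')) (Cx x) + 1 / 2"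
      using sq_norm_law_close[OF IJ(3,5) Cx cl, of x] by linarith
    then have "emeasure (sq_norm_law J (\<theta> \<mu>)) (Cx x) \<le> ennreal (measure (sq_norm_law J (\<theta> \<mu>')) (Cx x) + 1 / 2)"
      unfolding L.emeasure_eq_measure by (rule ennreal_leI)
    also have "\<dots> = emeasure (sq_norm_law J (\<theta> \<mu>')) (Cx x) + ennreal (1 / 2)"
      unfolding L'.emeasure_eq_measure by (rule ennreal_plus) auto
    finally show ?thesis .
  qed
  have agree': "\<mu>' i = \<mu> i" if "i \<in> I" for i
    using agree[of i] that by (simp add: I_def)
  have "emeasure ?P (E \<mu>) = (\<integral>\<^sup>+x. emeasure (sq_norm_law J (\<theta> \<mu>)) (Cx x) \<partial>?PI)"
    by (rule fold) simp
  also have "\<dots> \<le> (\<integral>\<^sup>+x. emeasure (sq_norm_law J (\<theta> \<mu>')) (Cx x) + ennreal (1 / 2) \<partial>?PI)"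
    by (intro nn_integral_mono pointwise)
  also have "\<dots> = (\<integral>\<^sup>+x. emeasure (sq_norm_law J (\<theta> \<mu>')) (Cx x) \<partial>?PI) + ennreal (1 / 2)"
    by (subst nn_integral_add[OF fold_meas[OF agree'] borel_measurable_const])
       (simp_all only: nn_integral_const PI.emeasure_space_1 mult_1_right)
  also have "\<dots> = emeasure ?P (E \<mu>') + ennreal (1 / 2)"
    by (subst fold[OF agree']) auto
  finally have "ennreal (obs_prob D \<delta> lam \<mu> A) \<le> ennreal (obs_prob D \<delta> lam \<mu>' A + 1 / 2)"
    unfolding prob_E[symmetric] by (subst ennreal_plus) (auto simp: obs_prob_def)
  then show ?thesis
    by (subst (asm) ennreal_le_iff) (auto simp: obs_prob_def)
qed

section \<open>Truncated second moments of the noise\<close>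

lemma distr_std_gauss_PiM_component:
  "i \<in> J \<Longrightarrow> distr (std_gauss_PiM J) std_gauss (\<lambda>z. z i) = std_gauss"
  by (rule distr_PiM_component[of J "\<lambda>_. std_gauss"]) (auto intro: prob_space_std_gauss)

lemma integral_std_gauss_sq: "(\<integral>x. x\<^sup>2 \<partial>std_gauss) = 1"
  and integrable_std_gauss_sq: "integrable std_gauss (\<lambda>x. x\<^sup>2)"
proof -
  show "(\<integral>x. x\<^sup>2 \<partial>std_gauss) = 1"
    using integral_std_normal_moment_even[of 1]
    by (subst integral_density) (auto simp: eval_nat_numeral)
  show "integrable std_gauss (\<lambda>x. x\<^sup>2)"
    using integrable_std_normal_moment[of 2] by (subst integrable_density) auto
qed

lemma
  assumes i: "i \<in> J"
  shows integral_component_sq: "(\<integral>z. (z i)\<^sup>2 \<partial>std_gauss_PiM J) = 1"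
    and integrable_component_sq: "integrable (std_gauss_PiM J) (\<lambda>z. (z i)\<^sup>2)"
proof -
  have m: "(\<lambda>z. z i) \<in> std_gauss_PiM J \<rightarrow>\<^sub>M std_gauss"
    using i by (intro measurable_component_singleton)
  have "(\<integral>x. x\<^sup>2 \<partial>distr (std_gauss_PiM J) std_gauss (\<lambda>z. z i)) = 1"
    unfolding distr_std_gauss_PiM_component[OF i] by (rule integral_std_gauss_sq)
  then show "(\<integral>z. (z i)\<^sup>2 \<partial>std_gauss_PiM J) = 1"
    by (subst (asm) integral_distr[OF m]) auto
  have "integrable (distr (std_gauss_PiM J) std_gauss (\<lambda>z. z i)) (\<lambda>x. x\<^sup>2)"
    unfolding distr_std_gauss_PiM_component[OF i] by (rule integrable_std_gauss_sq)
  then show "integrable (std_gauss_PiM J) (\<lambda>z. (z i)\<^sup>2)"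
    by (subst (asm) integrable_distr_eq[OF m]) auto
qed

text \<open>
  The normal density is at most \<open>1/2\<close>.
\<close>

lemma prob_std_gauss_near_0: "0 \<le> q \<Longrightarrow> measure std_gauss {-q..q} \<le> q"
proof -
  assume q: "0 \<le> q"
  have "2\<^sup>2 \<le> 2 * pi" using pi_gt3 by simp
  then have "2 \<le> sqrt (2 * pi)" by (rule real_le_rsqrt)
  then have d: "std_normal_density x \<le> 1 / 2" for x
  proof -
    have "1 / sqrt (2 * pi) \<le> 1 / 2"
      using \<open>2 \<le> sqrt (2 * pi)\<close> by (intro divide_left_mono) auto
    then have "1 / sqrt (2 * pi) * exp (- x\<^sup>2 / 2) \<le> 1 / 2 * 1"
      by (intro mult_mono) auto
    then show ?thesis by (simp add: std_normal_density_def)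
  qed
  have "emeasure std_gauss {-q..q} = (\<integral>\<^sup>+x. ennreal (std_normal_density x) * indicator {-q..q} x \<partial>lborel)"
    by (subst emeasure_density) auto
  also have "\<dots> \<le> (\<integral>\<^sup>+x. ennreal (1 / 2) * indicator {-q..q} x \<partial>lborel)"
    by (intro nn_integral_mono mult_right_mono ennreal_leI d) auto
  also have "\<dots> = ennreal (1 / 2) * ennreal (2 * q)"
    using q by (subst nn_integral_cmult_indicator) auto
  also have "\<dots> = ennreal q"
    using q by (subst ennreal_mult[symmetric]) auto
  finally show ?thesis
    using q by (simp add: gauss.emeasure_eq_measure)
qed

text \<open>
  Outside the event \<open>\<bar>z i\<bar> \<le> q\<close>, whose probability is at most \<open>q\<close>, the square is at least \<open>q\<^sup>2\<close>. The
  point is that the event \<open>A\<close> may depend on the noise in any way.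
\<close>

lemma truncated_second_moment_ge:
  assumes i: "i \<in> J" and A [measurable]: "A \<in> sets (std_gauss_PiM J)" and q: "0 \<le> q"
  shows "q\<^sup>2 * (measure (std_gauss_PiM J) A - q) \<le> (\<integral>z. indicator A z * (z i)\<^sup>2 \<partial>std_gauss_PiM J)"
proof -
  let ?P = "std_gauss_PiM J"
  interpret P: prob_space ?P by (rule prob_space_std_gauss_PiM)
  note [measurable] = i
  define S where "S = {z \<in> space ?P. z i \<in> {-q..q}}"
  have S [measurable]: "S \<in> sets ?P" unfolding S_def by measurable
  have m: "(\<lambda>z. z i) \<in> ?P \<rightarrow>\<^sub>M std_gauss"
    using i by (intro measurable_component_singleton)
  have "measure ?P S = measure (distr ?P std_gauss (\<lambda>z. z i)) {-q..q}"
    by (subst measure_distr[OF m]) (auto simp: S_def intro!: arg_cong[where f = "measure ?P"])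
  then have PS: "measure ?P S \<le> q"
    unfolding distr_std_gauss_PiM_component[OF i] using prob_std_gauss_near_0[OF q] by simp
  have "q\<^sup>2 * (measure ?P A - q) \<le> q\<^sup>2 * (measure ?P A - measure ?P S)"
    using PS by (intro mult_left_mono) auto
  also have "\<dots> = (\<integral>z. q\<^sup>2 * (indicator A z - indicator S z) \<partial>?P)"
    using A S by (simp add: P.emeasure_eq_measure)
  also have "\<dots> \<le> (\<integral>z. indicator A z * (z i)\<^sup>2 \<partial>?P)"
  proof (rule integral_mono)
    show "integrable ?P (\<lambda>z. q\<^sup>2 * (indicator A z - indicator S z))"
      by (simp add: P.emeasure_eq_measure)
    show "integrable ?P (\<lambda>z. indicator A z * (z i)\<^sup>2)"
      using integrable_mult_indicator[OF A integrable_component_sq[OF i]] by simp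
    fix z assume z: "z \<in> space ?P"
    show "q\<^sup>2 * (indicator A z - indicator S z) \<le> indicator A z * (z i)\<^sup>2"
    proof (cases "z \<in> S")
      case True
      then show ?thesis by (auto simp: indicator_def)
    next
      case False
      then have "\<bar>q\<bar> \<le> \<bar>z i\<bar>" using z q by (auto simp: S_def)
      then show ?thesis using False by (auto simp: indicator_def abs_le_square_iff)
    qed
  qed
  finally show ?thesis .
qed


section \<open>Lower bounds for the risk of a stopping rule\<close>

text \<open>
  The squared error of the truncated SVD estimate at the stopping index, as a function of the noise.
\<close>

definition tsvd_loss ::
    "nat \<Rightarrow> real \<Rightarrow> (nat \<Rightarrow> real) \<Rightarrow> (nat \<Rightarrow> real) \<Rightarrow> ((nat \<Rightarrow> real) \<Rightarrow> nat) \<Rightarrow> (nat \<Rightarrow> real) \<Rightarrow> real" where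
  "tsvd_loss D \<delta> lam \<mu> \<tau> z =
     (\<Sum>i\<in>{1..D}. if i \<le> \<tau> (canonical_observation D \<delta> lam \<mu> z)
        then \<delta>\<^sup>2 * inverse ((lam i)\<^sup>2) * (z i)\<^sup>2 else (\<mu> i)\<^sup>2)"

definition measurable_rule :: "nat \<Rightarrow> ((nat \<Rightarrow> real) \<Rightarrow> nat) \<Rightarrow> bool" where
  "measurable_rule D \<tau> \<longleftrightarrow> (\<forall>m. {y \<in> data_space D. \<tau> y \<le> m} \<in> sets (PiM {1..D} (\<lambda>_. borel)))"

lemma stopping_rule_event:
  "stopping_rule D \<tau> \<Longrightarrow> {y \<in> data_space D. \<tau> y \<le> m} \<in> sets (residual_filtration D m)"
  unfolding stopping_rule_def using stopping_timeD[of "residual_filtration D" \<tau> m]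
  by (auto simp: pred_def)

lemma stopping_rule_measurable: "stopping_rule D \<tau> \<Longrightarrow> measurable_rule D \<tau>"
  unfolding measurable_rule_def
  using residual_filtration_imp_borel[OF stopping_rule_event] by blast

definition stop_event ::
    "nat \<Rightarrow> real \<Rightarrow> (nat \<Rightarrow> real) \<Rightarrow> (nat \<Rightarrow> real) \<Rightarrow> ((nat \<Rightarrow> real) \<Rightarrow> nat) \<Rightarrow> nat \<Rightarrow> (nat \<Rightarrow> real) set" where
  "stop_event D \<delta> lam \<mu> \<tau> m =
     {z \<in> space (std_gauss_PiM {1..D}). \<tau> (canonical_observation D \<delta> lam \<mu> z) \<le> m}"

lemma stop_event_sets:
  assumes "measurable_rule D \<tau>"
  shows "stop_event D \<delta> lam \<mu> \<tau> m \<in> sets (std_gauss_PiM {1..D})"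
proof -
  have "canonical_observation D \<delta> lam \<mu> -` {y \<in> data_space D. \<tau> y \<le> m} \<inter> space (std_gauss_PiM {1..D})
      \<in> sets (std_gauss_PiM {1..D})"
    using assms by (intro measurable_sets[OF measurable_canonical_observation]) (auto simp: measurable_rule_def)
  also have "canonical_observation D \<delta> lam \<mu> -` {y \<in> data_space D. \<tau> y \<le> m} \<inter> space (std_gauss_PiM {1..D})
      = stop_event D \<delta> lam \<mu> \<tau> m"
    by (auto simp: stop_event_def)
  finally show ?thesis .
qed

lemma measure_stop_event:
  assumes "measurable_rule D \<tau>"
  shows "measure (std_gauss_PiM {1..D}) (stop_event D \<delta> lam \<mu> \<tau> m) = obs_prob D \<delta> lam \<mu> {y \<in> data_space D. \<tau> y \<le> m}"
  unfolding obs_prob_def using assms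
  by (subst measure_distr[OF measurable_canonical_observation])
     (auto simp: stop_event_def measurable_rule_def intro!: arg_cong[where f = "measure _"])

lemma tsvd_loss_measurable:
  assumes "measurable_rule D \<tau>"
  shows "tsvd_loss D \<delta> lam \<mu> \<tau> \<in> borel_measurable (std_gauss_PiM {1..D})"
  unfolding tsvd_loss_def
proof (rule borel_measurable_sum)
  fix i assume i: "i \<in> {1..D}"
  note [measurable] = i
  have "{z \<in> space (std_gauss_PiM {1..D}). i \<le> \<tau> (canonical_observation D \<delta> lam \<mu> z)}
      = space (std_gauss_PiM {1..D}) - stop_event D \<delta> lam \<mu> \<tau> (i - 1)"
    using i by (auto simp: stop_event_def)
  also have "\<dots> \<in> sets (std_gauss_PiM {1..D})"
    using stop_event_sets[OF assms] by auto
  finally have "{z \<in> space (std_gauss_PiM {1..D}). i \<le> \<tau> (canonical_observation D \<delta> lam \<mu> z)} \<in> sets (std_gauss_PiM {1..D})" .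
  then show "(\<lambda>z. if i \<le> \<tau> (canonical_observation D \<delta> lam \<mu> z)
        then \<delta>\<^sup>2 * inverse ((lam i)\<^sup>2) * (z i)\<^sup>2 else (\<mu> i)\<^sup>2) \<in> borel_measurable (std_gauss_PiM {1..D})"
    by (rule measurable_If[rotated 2]) measurable
qed

lemma tsvd_loss_integrable:
  assumes "measurable_rule D \<tau>"
  shows "integrable (std_gauss_PiM {1..D}) (tsvd_loss D \<delta> lam \<mu> \<tau>)"
proof (rule Bochner_Integration.integrable_bound[OF _ tsvd_loss_measurable[OF assms]])
  interpret P: prob_space "std_gauss_PiM {1..D}" by (rule prob_space_std_gauss_PiM)
  show "integrable (std_gauss_PiM {1..D}) (\<lambda>z. \<Sum>i\<in>{1..D}. \<delta>\<^sup>2 * inverse ((lam i)\<^sup>2) * (z i)\<^sup>2 + (\<mu> i)\<^sup>2)"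
    by (intro Bochner_Integration.integrable_sum Bochner_Integration.integrable_add
          integrable_mult_right integrable_component_sq P.integrable_const)
  show "AE z in std_gauss_PiM {1..D}. norm (tsvd_loss D \<delta> lam \<mu> \<tau> z)
      \<le> norm (\<Sum>i\<in>{1..D}. \<delta>\<^sup>2 * inverse ((lam i)\<^sup>2) * (z i)\<^sup>2 + (\<mu> i)\<^sup>2)"
  proof (rule AE_I2)
    fix z
    have "0 \<le> tsvd_loss D \<delta> lam \<mu> \<tau> z" unfolding tsvd_loss_def by (intro sum_nonneg) auto
    moreover have "tsvd_loss D \<delta> lam \<mu> \<tau> z \<le> (\<Sum>i\<in>{1..D}. \<delta>\<^sup>2 * inverse ((lam i)\<^sup>2) * (z i)\<^sup>2 + (\<mu> i)\<^sup>2)"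
      unfolding tsvd_loss_def by (intro sum_mono) auto
    ultimately show "norm (tsvd_loss D \<delta> lam \<mu> \<tau> z)
      \<le> norm (\<Sum>i\<in>{1..D}. \<delta>\<^sup>2 * inverse ((lam i)\<^sup>2) * (z i)\<^sup>2 + (\<mu> i)\<^sup>2)"
      by simp
  qed
qed

lemma model_lam_pos:
  assumes "gaussian_sequence_model M D \<delta> lam \<epsilon>" "i \<in> {1..D}"
  shows "0 < lam i"
proof -
  have "lam D \<le> lam i"
    using assms by (auto simp: gaussian_sequence_model_def monotone_on_def)
  then show ?thesis using assms by (auto simp: gaussian_sequence_model_def)
qed

text \<open>
  The noise variables are independent and standard normal, so their joint law is the product measure and
  the risk can be computed on the canonical space.
\<close>

lemma sq_risk_eq_integral_loss:
  assumes model: "gaussian_sequence_model M D \<delta> lam \<epsilon>" and \<tau>: "measurable_rule D \<tau>"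
  shows "sq_risk M D \<delta> lam \<epsilon> \<mu> \<tau> = (\<integral>z. tsvd_loss D \<delta> lam \<mu> \<tau> z \<partial>std_gauss_PiM {1..D})"
proof -
  have D: "{1..D} \<noteq> {}"
    using model by (auto simp: gaussian_sequence_model_def)
  interpret M: prob_space M
    using model by (simp add: gaussian_sequence_model_def)
  have dist: "distributed M lborel (\<epsilon> i) std_normal_density" if "i \<in> {1..D}" for i
    using model that by (simp add: gaussian_sequence_model_def)
  have rv [measurable]: "\<epsilon> i \<in> borel_measurable M" if "i \<in> {1..D}" for i
    using distributed_measurable[OF dist[OF that]] by simp
  define X where "X \<omega> = (\<lambda>i\<in>{1..D}. \<epsilon> i \<omega>)" for \<omega>
  have X: "X \<in> M \<rightarrow>\<^sub>M PiM {1..D} (\<lambda>_. borel)"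
    unfolding X_def by (intro measurable_restrict rv)
  have "distr M (PiM {1..D} (\<lambda>_. borel)) X = PiM {1..D} (\<lambda>i. distr M borel (\<epsilon> i))"
    unfolding X_def
    by (rule M.indep_vars_iff_distr_eq_PiM'[THEN iffD1, OF D rv])
       (use model in \<open>auto simp: gaussian_sequence_model_def\<close>)
  also have "\<dots> = std_gauss_PiM {1..D}"
  proof (rule PiM_cong[OF refl])
    fix i assume "i \<in> {1..D}"
    from distributed_distr_eq_density[OF dist[OF this]]
    show "distr M borel (\<epsilon> i) = std_gauss"
      by (simp cong: distr_cong)
  qed
  finally have law: "distr M (PiM {1..D} (\<lambda>_. borel)) X = std_gauss_PiM {1..D}" .
  have obs: "observation D \<delta> lam \<epsilon> \<mu> \<omega> = canonical_observation D \<delta> lam \<mu> (X \<omega>)" for \<omega>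
    by (auto simp: observation_def X_def)
  have loss: "(L2_set (\<lambda>i. tsvd lam (\<tau> (observation D \<delta> lam \<epsilon> \<mu> \<omega>)) (observation D \<delta> lam \<epsilon> \<mu> \<omega>) i - \<mu> i) {1..D})\<^sup>2
     = tsvd_loss D \<delta> lam \<mu> \<tau> (X \<omega>)" for \<omega>
    unfolding L2_set_sq tsvd_loss_def obs
  proof (rule sum.cong[OF refl])
    fix i assume i: "i \<in> {1..D}"
    have "inverse (lam i) * (lam i * \<mu> i + \<delta> * X \<omega> i) - \<mu> i = \<delta> * inverse (lam i) * X \<omega> i"
      using model_lam_pos[OF model i] by (simp add: field_simps)
    then show "(tsvd lam (\<tau> (canonical_observation D \<delta> lam \<mu> (X \<omega>))) (canonical_observation D \<delta> lam \<mu> (X \<omega>)) i - \<mu> i)\<^sup>2 =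
      (if i \<le> \<tau> (canonical_observation D \<delta> lam \<mu> (X \<omega>)) then \<delta>\<^sup>2 * inverse ((lam i)\<^sup>2) * (X \<omega> i)\<^sup>2 else (\<mu> i)\<^sup>2)"
      using i by (simp add: tsvd_def observation_def power_mult_distrib power_inverse)
  qed
  have "sq_risk M D \<delta> lam \<epsilon> \<mu> \<tau> = (\<integral>\<omega>. tsvd_loss D \<delta> lam \<mu> \<tau> (X \<omega>) \<partial>M)"
    unfolding sq_risk_def Let_def loss ..
  also have "\<dots> = (\<integral>z. tsvd_loss D \<delta> lam \<mu> \<tau> z \<partial>distr M (PiM {1..D} (\<lambda>_. borel)) X)"
    using tsvd_loss_measurable[OF \<tau>, of \<delta> lam \<mu>]
    by (subst integral_distr[OF X]) (auto simp: law[symmetric])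
  finally show ?thesis unfolding law .
qed

lemma sq_risk_ge_strong_bias:
  assumes model: "gaussian_sequence_model M D \<delta> lam \<epsilon>" and \<tau>: "measurable_rule D \<tau>"
  shows "strong_bias_sq D m \<mu> * obs_prob D \<delta> lam \<mu> {y \<in> data_space D. \<tau> y \<le> m} \<le> sq_risk M D \<delta> lam \<epsilon> \<mu> \<tau>"
proof -
  let ?P = "std_gauss_PiM {1..D}" and ?A = "stop_event D \<delta> lam \<mu> \<tau> m"
  interpret P: prob_space ?P by (rule prob_space_std_gauss_PiM)
  note A [measurable] = stop_event_sets[OF \<tau>, of \<delta> lam \<mu> m]
  have "strong_bias_sq D m \<mu> * measure ?P ?A = (\<integral>z. strong_bias_sq D m \<mu> * indicator ?A z \<partial>?P)"
    using A by simp
  also have "\<dots> \<le> (\<integral>z. tsvd_loss D \<delta> lam \<mu> \<tau> z \<partial>?P)"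
  proof (rule integral_mono[OF _ tsvd_loss_integrable[OF \<tau>]])
    show "integrable ?P (\<lambda>z. strong_bias_sq D m \<mu> * indicator ?A z)"
      by (intro integrable_mult_right integrable_real_indicator A)
        (simp only: P.emeasure_eq_measure infinity_ennreal_def ennreal_less_top)
    fix z
    show "strong_bias_sq D m \<mu> * indicator ?A z \<le> tsvd_loss D \<delta> lam \<mu> \<tau> z"
    proof (cases "z \<in> ?A")
      case True
      then have "strong_bias_sq D m \<mu> * indicator ?A z = (\<Sum>i\<in>{m+1..D}. if i \<le> \<tau> (canonical_observation D \<delta> lam \<mu> z)
        then \<delta>\<^sup>2 * inverse ((lam i)\<^sup>2) * (z i)\<^sup>2 else (\<mu> i)\<^sup>2)"
        by (auto simp: strong_bias_sq_def stop_event_def intro!: sum.cong)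
      also have "\<dots> \<le> tsvd_loss D \<delta> lam \<mu> \<tau> z"
        unfolding tsvd_loss_def by (intro sum_mono2) auto
      finally show ?thesis .
    next
      case False
      then show ?thesis by (auto simp: tsvd_loss_def intro!: sum_nonneg)
    qed
  qed
  finally show ?thesis
    unfolding sq_risk_eq_integral_loss[OF model \<tau>] measure_stop_event[OF \<tau>] .
qed

text \<open>
  Stopping after \<open>m\<close> costs the stochastic error of the first \<open>m + 1\<close> coordinates. Since
  the stopping rule looks at the total norm, the event \<open>{\<tau> > m}\<close> may depend on each of these errors,
  so that the expectation does not factorise; the truncated second moment bounds it from below
  coordinate by coordinate.
\<close>

lemma sq_risk_ge_strong_variance:
  assumes model: "gaussian_sequence_model M D \<delta> lam \<epsilon>" and \<tau>: "measurable_rule D \<tau>"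
    and m: "m < D" and q: "0 \<le> q"
  shows "strong_variance \<delta> lam (m + 1) * (q\<^sup>2 * (1 - obs_prob D \<delta> lam \<mu> {y \<in> data_space D. \<tau> y \<le> m} - q))
    \<le> sq_risk M D \<delta> lam \<epsilon> \<mu> \<tau>"
proof -
  let ?P = "std_gauss_PiM {1..D}" and ?w = "\<lambda>i. \<delta>\<^sup>2 * inverse ((lam i)\<^sup>2)"
  define A where "A = space ?P - stop_event D \<delta> lam \<mu> \<tau> m"
  interpret P: prob_space ?P by (rule prob_space_std_gauss_PiM)
  have A [measurable]: "A \<in> sets ?P"
    unfolding A_def using stop_event_sets[OF \<tau>] by auto
  have PA: "measure ?P A = 1 - obs_prob D \<delta> lam \<mu> {y \<in> data_space D. \<tau> y \<le> m}"
    unfolding A_def using P.prob_compl[OF stop_event_sets[OF \<tau>]] measure_stop_event[OF \<tau>] by metis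
  have int: "integrable ?P (\<lambda>z. ?w i * (indicator A z * (z i)\<^sup>2))" if "i \<in> {1..m+1}" for i
    using that m integrable_mult_indicator[OF A integrable_component_sq[of i "{1..D}"]]
    by (intro integrable_mult_right) auto
  have "strong_variance \<delta> lam (m + 1) * (q\<^sup>2 * (measure ?P A - q)) = (\<Sum>i\<in>{1..m+1}. ?w i * (q\<^sup>2 * (measure ?P A - q)))"
    by (simp only: strong_variance_def sum_distrib_left sum_distrib_right)
  also have "\<dots> \<le> (\<Sum>i\<in>{1..m+1}. ?w i * (\<integral>z. indicator A z * (z i)\<^sup>2 \<partial>?P))"
    using m q by (intro sum_mono mult_left_mono truncated_second_moment_ge A) auto
  also have "\<dots> = (\<integral>z. (\<Sum>i\<in>{1..m+1}. ?w i * (indicator A z * (z i)\<^sup>2)) \<partial>?P)"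
    using int by (subst Bochner_Integration.integral_sum) auto
  also have "\<dots> \<le> (\<integral>z. tsvd_loss D \<delta> lam \<mu> \<tau> z \<partial>?P)"
  proof (rule integral_mono[OF _ tsvd_loss_integrable[OF \<tau>]])
    show "integrable ?P (\<lambda>z. \<Sum>i\<in>{1..m+1}. ?w i * (indicator A z * (z i)\<^sup>2))"
      by (intro Bochner_Integration.integrable_sum int)
    fix z
    show "(\<Sum>i\<in>{1..m+1}. ?w i * (indicator A z * (z i)\<^sup>2)) \<le> tsvd_loss D \<delta> lam \<mu> \<tau> z"
    proof (cases "z \<in> A")
      case True
      then have "(\<Sum>i\<in>{1..m+1}. ?w i * (indicator A z * (z i)\<^sup>2))
        = (\<Sum>i\<in>{1..m+1}. if i \<le> \<tau> (canonical_observation D \<delta> lam \<mu> z) then ?w i * (z i)\<^sup>2 else (\<mu> i)\<^sup>2)"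
        by (intro sum.cong) (auto simp: A_def stop_event_def)
      also have "\<dots> \<le> tsvd_loss D \<delta> lam \<mu> \<tau> z"
        unfolding tsvd_loss_def using m by (intro sum_mono2) auto
      finally show ?thesis .
    next
      case False
      then show ?thesis by (auto simp: tsvd_loss_def intro!: sum_nonneg)
    qed
  qed
  finally show ?thesis
    unfolding sq_risk_eq_integral_loss[OF model \<tau>] PA .
qed

lemma sq_risk_const:
  assumes model: "gaussian_sequence_model M D \<delta> lam \<epsilon>" and m: "m \<le> D"
  shows "sq_risk M D \<delta> lam \<epsilon> \<mu> (\<lambda>_. m) = strong_variance \<delta> lam m + strong_bias_sq D m \<mu>"
proof -
  let ?P = "std_gauss_PiM {1..D}" and ?w = "\<lambda>i. \<delta>\<^sup>2 * inverse ((lam i)\<^sup>2)"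
  interpret P: prob_space ?P by (rule prob_space_std_gauss_PiM)
  have \<tau>: "measurable_rule D (\<lambda>_. m)"
    by (auto simp: measurable_rule_def space_PiM_data[symmetric])
  have loss: "tsvd_loss D \<delta> lam \<mu> (\<lambda>_. m) z = (\<Sum>i\<in>{1..m}. ?w i * (z i)\<^sup>2) + strong_bias_sq D m \<mu>" for z
  proof -
    have "{1..D} = {1..m} \<union> {m+1..D}" using m by auto
    then show ?thesis
      unfolding tsvd_loss_def strong_bias_sq_def
      by (simp only:) (subst sum.union_disjoint, auto intro!: sum.cong arg_cong2[where f = "(+)"])
  qed
  have "(\<integral>z. tsvd_loss D \<delta> lam \<mu> (\<lambda>_. m) z \<partial>?P) = (\<Sum>i\<in>{1..m}. ?w i * (\<integral>z. (z i)\<^sup>2 \<partial>?P)) + strong_bias_sq D m \<mu>"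
  proof -
    have int: "integrable ?P (\<lambda>z. ?w i * (z i)\<^sup>2)" if "i \<in> {1..m}" for i
      using that m by (intro integrable_mult_right integrable_component_sq) auto
    have "(\<integral>z. tsvd_loss D \<delta> lam \<mu> (\<lambda>_. m) z \<partial>?P)
        = (\<integral>z. (\<Sum>i\<in>{1..m}. ?w i * (z i)\<^sup>2) \<partial>?P) + (\<integral>z. strong_bias_sq D m \<mu> \<partial>?P)"
      unfolding loss using int
      by (intro Bochner_Integration.integral_add Bochner_Integration.integrable_sum P.integrable_const)
    also have "(\<integral>z. (\<Sum>i\<in>{1..m}. ?w i * (z i)\<^sup>2) \<partial>?P) = (\<Sum>i\<in>{1..m}. ?w i * (\<integral>z. (z i)\<^sup>2 \<partial>?P))"
      using int by (subst Bochner_Integration.integral_sum) auto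
    also have "(\<integral>z. strong_bias_sq D m \<mu> \<partial>?P) = strong_bias_sq D m \<mu>"
      by (simp only: lebesgue_integral_const P.prob_space scaleR_one)
    finally show ?thesis .
  qed
  also have "(\<Sum>i\<in>{1..m}. ?w i * (\<integral>z. (z i)\<^sup>2 \<partial>?P)) = strong_variance \<delta> lam m"
    using m by (simp add: strong_variance_def sum_distrib_left integral_component_sq)
  finally show ?thesis
    unfolding sq_risk_eq_integral_loss[OF model \<tau>] .
qed

lemma mean_le_mean_of_longer_prefix:
  fixes w :: "nat \<Rightarrow> real"
  assumes mono: "\<And>i j. 1 \<le> i \<Longrightarrow> i \<le> j \<Longrightarrow> j \<le> n \<Longrightarrow> w i \<le> w j" and "m \<le> n"
  shows "real n * (\<Sum>i=1..m. w i) \<le> real m * (\<Sum>i=1..n. w i)"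
proof -
  have split: "{1..n} = {1..m} \<union> {m+1..n}" using \<open>m \<le> n\<close> by auto
  have sum: "(\<Sum>i=1..n. w i) = (\<Sum>i=1..m. w i) + (\<Sum>i=m+1..n. w i)"
    unfolding split by (subst sum.union_disjoint) auto
  have "real (n - m) * (\<Sum>i=1..m. w i) = (\<Sum>i=1..m. \<Sum>j=m+1..n. w i)"
    using \<open>m \<le> n\<close> by (simp add: sum_distrib_left)
  also have "\<dots> \<le> (\<Sum>i=1..m. \<Sum>j=m+1..n. w j)"
    by (intro sum_mono mono) auto
  also have "\<dots> = real m * (\<Sum>j=m+1..n. w j)"
    by simp
  finally show ?thesis
    unfolding sum using \<open>m \<le> n\<close> by (simp add: of_nat_diff algebra_simps)
qed

lemma strong_oracle_props:
  "strong_oracle D \<delta> lam \<mu> \<le> D"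
  "strong_bias_sq D (strong_oracle D \<delta> lam \<mu>) \<mu> \<le> strong_variance \<delta> lam (strong_oracle D \<delta> lam \<mu>)"
proof -
  let ?S = "{m \<in> {0..D}. strong_bias_sq D m \<mu> \<le> strong_variance \<delta> lam m}"
  have "D \<in> ?S" by (auto simp: strong_bias_sq_def strong_variance_def intro!: mult_nonneg_nonneg sum_nonneg)
  then have "strong_oracle D \<delta> lam \<mu> \<in> ?S"
    unfolding strong_oracle_def by (intro Min_in) auto
  then show "strong_oracle D \<delta> lam \<mu> \<le> D"
    "strong_bias_sq D (strong_oracle D \<delta> lam \<mu>) \<mu> \<le> strong_variance \<delta> lam (strong_oracle D \<delta> lam \<mu>)"
    by auto
qed

lemma strong_variance_nonneg: "0 \<le> strong_variance \<delta> lam m"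
  by (auto simp: strong_variance_def intro!: mult_nonneg_nonneg sum_nonneg)

text \<open>
  \<open>V\<^sub>n / n\<close> is the average of the first \<open>n\<close> terms of a nondecreasing sequence.
\<close>

lemma strong_variance_ratio:
  assumes model: "gaussian_sequence_model M D \<delta> lam \<epsilon>" and "m \<le> n" "n \<le> D"
  shows "real n * strong_variance \<delta> lam m \<le> real m * strong_variance \<delta> lam n"
proof -
  have "inverse ((lam i)\<^sup>2) \<le> inverse ((lam j)\<^sup>2)" if "1 \<le> i" "i \<le> j" "j \<le> n" for i j
  proof -
    have "0 < lam j" using that \<open>n \<le> D\<close> by (intro model_lam_pos[OF model]) auto
    moreover have "lam j \<le> lam i"
      using model that \<open>n \<le> D\<close> by (auto simp: gaussian_sequence_model_def monotone_on_def)
    ultimately show ?thesis by (intro le_imp_inverse_le power_mono) auto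
  qed
  from mean_le_mean_of_longer_prefix[of n "\<lambda>i. inverse ((lam i)\<^sup>2)" m, OF this \<open>m \<le> n\<close>]
  have "\<delta>\<^sup>2 * (real n * (\<Sum>i=1..m. inverse ((lam i)\<^sup>2))) \<le> \<delta>\<^sup>2 * (real m * (\<Sum>i=1..n. inverse ((lam i)\<^sup>2)))"
    by (intro mult_left_mono) auto
  then show ?thesis by (simp add: strong_variance_def mult_ac)
qed

lemma strong_variance_pos:
  assumes model: "gaussian_sequence_model M D \<delta> lam \<epsilon>" and "1 \<le> n" "n \<le> D"
  shows "0 < strong_variance \<delta> lam n"
proof -
  have "0 < \<delta>" using model by (simp add: gaussian_sequence_model_def)
  moreover have "0 < (\<Sum>i=1..n. inverse ((lam i)\<^sup>2))"
  proof (rule sum_pos)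
    fix i assume "i \<in> {1..n}"
    then have "0 < lam i" using \<open>n \<le> D\<close> by (intro model_lam_pos[OF model]) auto
    then show "0 < inverse ((lam i)\<^sup>2)" by simp
  qed (use \<open>1 \<le> n\<close> in auto)
  ultimately show ?thesis by (simp add: strong_variance_def)
qed

section \<open>The lower bound under an indistinguishable signal\<close>

text \<open>
  Applied to the signal \<open>\<mu>\<close>, the lower bound by the variance shows that stopping late is unlikely;
  \<open>obs_prob_le_add_half\<close> carries this over to \<open>\<mu>'\<close>, where the lower bound by the bias takes over.
\<close>

lemma sq_risk_ge_strong_bias_of_indistinguishable:
  assumes model: "gaussian_sequence_model M D \<delta> lam \<epsilon>" and rule: "stopping_rule D \<tau>" and m: "m < D"
    and small: "200 * sq_risk M D \<delta> lam \<epsilon> \<mu> \<tau> \<le> strong_variance \<delta> lam (m + 1)"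
    and agree: "\<And>i. i \<in> {1..m} \<Longrightarrow> \<mu> i = \<mu>' i"
    and close: "\<bar>weak_bias_sq D lam m \<mu>' - weak_bias_sq D lam m \<mu>\<bar> \<le> sqrt (real (D - m)) / 5 * \<delta>\<^sup>2"
  shows "0.05 * strong_bias_sq D m \<mu>' \<le> sq_risk M D \<delta> lam \<epsilon> \<mu>' \<tau>"
proof -
  let ?V = "strong_variance \<delta> lam (m + 1)"
  define A where "A = {y \<in> data_space D. \<tau> y \<le> m}"
  have \<tau>: "measurable_rule D \<tau>"
    by (rule stopping_rule_measurable[OF rule])
  have \<delta>: "0 < \<delta>"
    using model by (simp add: gaussian_sequence_model_def)
  have V: "0 < ?V"
    using m by (intro strong_variance_pos[OF model]) auto
  \<comment> \<open>The bound for the probability of stopping late is \<open>1 / (200 q\<^sup>2) + q\<close>; the value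
    \<open>q = 1/5\<close> is close to its minimiser.\<close>
  have "?V * ((1/5)\<^sup>2 * (1 - obs_prob D \<delta> lam \<mu> A - 1/5)) \<le> sq_risk M D \<delta> lam \<epsilon> \<mu> \<tau>"
    unfolding A_def by (rule sq_risk_ge_strong_variance[OF model \<tau> m]) simp
  also have "\<dots> \<le> ?V * (1/200)"
    using small by simp
  finally have "(1/5)\<^sup>2 * (1 - obs_prob D \<delta> lam \<mu> A - 1/5) \<le> 1/200"
    using V by (simp only: mult_le_cancel_left_pos)
  then have "27/40 \<le> obs_prob D \<delta> lam \<mu> A"
    by (simp add: power2_eq_square)
  also have "obs_prob D \<delta> lam \<mu> A \<le> obs_prob D \<delta> lam \<mu>' A + 1/2"
    unfolding A_def by (rule obs_prob_le_add_half[OF stopping_rule_event[OF rule] m \<delta> agree close])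
  finally have "0.05 \<le> obs_prob D \<delta> lam \<mu>' A"
    by simp
  then have "0.05 * strong_bias_sq D m \<mu>' \<le> obs_prob D \<delta> lam \<mu>' A * strong_bias_sq D m \<mu>'"
    by (intro mult_right_mono) (auto simp: strong_bias_sq_def intro: sum_nonneg)
  also have "\<dots> \<le> sq_risk M D \<delta> lam \<epsilon> \<mu>' \<tau>"
    using sq_risk_ge_strong_bias[OF model \<tau>, of m \<mu>'] by (simp add: A_def mult.commute)
  finally show ?thesis .
qed

lemma strong_variance_ge_of_oracle_inequality:
  fixes C :: real
  assumes model: "gaussian_sequence_model M D \<delta> lam \<epsilon>" and "1 \<le> C"
    and risk_le: "R \<le> C * sq_risk M D \<delta> lam \<epsilon> \<mu> (\<lambda>_. strong_oracle D \<delta> lam \<mu>)"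
    and m: "m < D" and large: "400 * C * real (strong_oracle D \<delta> lam \<mu>) \<le> real m"
  shows "200 * R \<le> strong_variance \<delta> lam (m + 1)"
proof -
  let ?s = "strong_oracle D \<delta> lam \<mu>" and ?V = "strong_variance \<delta> lam"
  have "sq_risk M D \<delta> lam \<epsilon> \<mu> (\<lambda>_. ?s) \<le> 2 * ?V ?s"
    unfolding sq_risk_const[OF model strong_oracle_props(1)]
    using strong_oracle_props(2)[where D = D and \<mu> = \<mu> and \<delta> = \<delta> and lam = lam] by simp
  then have "C * sq_risk M D \<delta> lam \<epsilon> \<mu> (\<lambda>_. ?s) \<le> C * (2 * ?V ?s)"
    using \<open>1 \<le> C\<close> by (intro mult_left_mono) auto
  then have R: "200 * R \<le> 400 * C * ?V ?s"
    using risk_le by simp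
  show ?thesis
  proof (cases "?s = 0")
    case True
    then have "?V ?s = 0" by (simp add: strong_variance_def)
    then show ?thesis using R strong_variance_nonneg[of \<delta> lam "m + 1"] by simp
  next
    case False
    have "1 * real ?s \<le> 400 * C * real ?s"
      using \<open>1 \<le> C\<close> by (intro mult_right_mono) auto
    then have s: "?s \<le> m + 1" using large by simp
    have "400 * C * real ?s * ?V ?s \<le> real (m + 1) * ?V ?s"
      using large by (intro mult_right_mono strong_variance_nonneg) auto
    also have "\<dots> \<le> real ?s * ?V (m + 1)"
      using m by (intro strong_variance_ratio[OF model s]) auto
    finally have "real ?s * (400 * C * ?V ?s) \<le> real ?s * ?V (m + 1)"
      by (simp only: mult_ac)
    then have "400 * C * ?V ?s \<le> ?V (m + 1)"
      using False by simp
    then show ?thesis using R by simp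
  qed
qed

theorem proposition2p4:
  fixes M :: "'a measure" and D :: nat and \<delta> :: real and lam :: "nat \<Rightarrow> real"
    and \<epsilon> :: "nat \<Rightarrow> 'a \<Rightarrow> real" and \<tau> :: "(nat \<Rightarrow> real) \<Rightarrow> nat" and \<mu> :: "nat \<Rightarrow> real"
  assumes model: "gaussian_sequence_model M D \<delta> lam \<epsilon>"
    and rule: "stopping_rule D \<tau>"
  shows
    "(\<forall>i\<^sub>0\<in>{1..D-1}. strong_variance \<delta> lam (i\<^sub>0 + 1) \<ge> 200 * sq_risk M D \<delta> lam \<epsilon> \<mu> \<tau> \<longrightarrow>
       (\<forall>\<mu>' :: nat \<Rightarrow> real.
          (\<forall>i\<in>{1..i\<^sub>0}. \<mu> i = \<mu>' i) \<longrightarrow>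
          \<bar>weak_bias_sq D lam i\<^sub>0 \<mu>' - weak_bias_sq D lam i\<^sub>0 \<mu>\<bar>
            \<le> 0.05 * (sqrt (real D - real i\<^sub>0) / 2) * \<delta>\<^sup>2 \<longrightarrow>
          weak_bias D lam i\<^sub>0 \<mu> + weak_bias D lam i\<^sub>0 \<mu>' \<ge> 5.25 * \<delta> \<longrightarrow>
          sq_risk M D \<delta> lam \<epsilon> \<mu>' \<tau> \<ge> 0.05 * strong_bias_sq D i\<^sub>0 \<mu>'))
     \<and> (\<forall>C \<ge> (1::real).
          sq_risk M D \<delta> lam \<epsilon> \<mu> \<tau>
            \<le> C * sq_risk M D \<delta> lam \<epsilon> \<mu> (\<lambda>_. strong_oracle D \<delta> lam \<mu>) \<longrightarrow>
          (\<forall>i\<^sub>0\<in>{1..D-1}. real i\<^sub>0 \<ge> 400 * C * real (strong_oracle D \<delta> lam \<mu>) \<longrightarrow>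
             strong_variance \<delta> lam (i\<^sub>0 + 1) \<ge> 200 * sq_risk M D \<delta> lam \<epsilon> \<mu> \<tau>))"
proof (intro conjI ballI allI impI)
  fix i\<^sub>0 and \<mu>' :: "nat \<Rightarrow> real"
  assume i0: "i\<^sub>0 \<in> {1..D-1}"
    and small: "200 * sq_risk M D \<delta> lam \<epsilon> \<mu> \<tau> \<le> strong_variance \<delta> lam (i\<^sub>0 + 1)"
    and agree: "\<forall>i\<in>{1..i\<^sub>0}. \<mu> i = \<mu>' i"
    and close: "\<bar>weak_bias_sq D lam i\<^sub>0 \<mu>' - weak_bias_sq D lam i\<^sub>0 \<mu>\<bar>
            \<le> 0.05 * (sqrt (real D - real i\<^sub>0) / 2) * \<delta>\<^sup>2"
  have m: "i\<^sub>0 < D" using i0 by auto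
  have "0.05 * (sqrt (real D - real i\<^sub>0) / 2) * \<delta>\<^sup>2 \<le> sqrt (real (D - i\<^sub>0)) / 5 * \<delta>\<^sup>2"
    using m by (intro mult_right_mono) (auto simp: of_nat_diff)
  with close have close': "\<bar>weak_bias_sq D lam i\<^sub>0 \<mu>' - weak_bias_sq D lam i\<^sub>0 \<mu>\<bar>
      \<le> sqrt (real (D - i\<^sub>0)) / 5 * \<delta>\<^sup>2"
    by linarith
  show "0.05 * strong_bias_sq D i\<^sub>0 \<mu>' \<le> sq_risk M D \<delta> lam \<epsilon> \<mu>' \<tau>"
    using agree by (intro sq_risk_ge_strong_bias_of_indistinguishable[OF model rule m small _ close']) auto
next
  fix C :: real and i\<^sub>0
  assume "1 \<le> C" "sq_risk M D \<delta> lam \<epsilon> \<mu> \<tau> \<le> C * sq_risk M D \<delta> lam \<epsilon> \<mu> (\<lambda>_. strong_oracle D \<delta> lam \<mu>)"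
    and "i\<^sub>0 \<in> {1..D-1}" "400 * C * real (strong_oracle D \<delta> lam \<mu>) \<le> real i\<^sub>0"
  then show "200 * sq_risk M D \<delta> lam \<epsilon> \<mu> \<tau> \<le> strong_variance \<delta> lam (i\<^sub>0 + 1)"
    by (intro strong_variance_ge_of_oracle_inequality[OF model]) auto
qed

end
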